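(* Let $(\mathbb{X},|\cdot|)$ be a Banach space and let $f:\mathbb{R}\to\mathbb{X}$ be Bohr-almost periodic. Then for any fixed $\alpha\in\mathbb{R}$ with $|\alpha|>1$, \[ \lim_{N\to\infty}\frac{1}{N}\sum_{n=0}^{N-1} f(\alpha^n x)=M(f) \] (limit in the norm of $\mathbb{X}$) for Lebesgue-almost every $x\in\mathbb{R}$.
   Context: A continuous function $f:\mathbb{R}\to\mathbb{X}$ into a Banach space is Bohr-almost periodic if for every $\varepsilon>0$ the set $\{t\in\mathbb{R}: \sup_{x\in\mathbb{R}}|f(x)-f(x-t)|<\varepsilon\}$ is relatively dense in $\mathbb{R}$ (equivalently, $f$ is a uniform limit on $\mathbb{R}$ of $\mathbb{X}$-valued trigonometric polynomials $a_0+\sum_{\ell=1}^m e^{2\pi i k_\ell x}a_\ell$ with $a_\ell\in\mathbb{X}$, $k_\ell\in\mathbb{R}$). Its mean is $M(f)=\lim_{T\to\infty}\frac{1}{2T}\int_{-T}^{T}f(y)\,\mathrm{d}y\in\mathbb{X}$, where the integral is the Bochner integral. *)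

theory Defs
  imports "HOL-Analysis.Analysis"
begin

text \<open>
  The library's Bochner integral is restricted to second-countable (i.e. separable) spaces.
  The following is the same construction without that restriction, so that it applies to
  functions with values in an arbitrary Banach space.
\<close>

inductive has_Bochner_integral ::
  "'a measure \<Rightarrow> ('a \<Rightarrow> 'b::real_normed_vector) \<Rightarrow> 'b \<Rightarrow> bool"
  for M f x where
  "f \<in> borel_measurable M \<Longrightarrow>
    (\<And>i. Bochner_Integration.simple_bochner_integrable M (s i)) \<Longrightarrow>
    (\<lambda>i. \<integral>\<^sup>+y. norm (f y - s i y) \<partial>M) \<longlonglongrightarrow> 0 \<Longrightarrow>
    (\<lambda>i. Bochner_Integration.simple_bochner_integral M (s i)) \<longlonglongrightarrow> x \<Longrightarrow>
    has_Bochner_integral M f x"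

definition Bochner_integral :: "'a measure \<Rightarrow> ('a \<Rightarrow> 'b::real_normed_vector) \<Rightarrow> 'b" where
  "Bochner_integral M f =
    (if \<exists>x. has_Bochner_integral M f x then THE x. has_Bochner_integral M f x else 0)"

lemma Bochner_integral_eq_lebesgue_integral:
  fixes f :: "'a \<Rightarrow> 'b::{real_normed_vector, second_countable_topology}"
  shows "Bochner_integral M f = lebesgue_integral M f"
  unfolding Bochner_integral_def lebesgue_integral_def
    has_Bochner_integral.simps has_bochner_integral.simps ..

definition relatively_dense :: "real set \<Rightarrow> bool" where
  "relatively_dense S \<longleftrightarrow> (\<exists>L>0. \<forall>a. S \<inter> {a..a + L} \<noteq> {})"

text \<open>
  The supremum is taken in the extended reals because it may be infinite
  for a function that is not yet known to be bounded.
\<close>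

definition Bohr_almost_periodic :: "(real \<Rightarrow> 'a::real_normed_vector) \<Rightarrow> bool" where
  "Bohr_almost_periodic f \<longleftrightarrow>
    continuous_on UNIV f \<and>
    (\<forall>\<epsilon>>0. relatively_dense {t. (SUP x. ereal (norm (f x - f (x - t)))) < ereal \<epsilon>})"

definition mean :: "(real \<Rightarrow> 'a::banach) \<Rightarrow> 'a" where
  "mean f = Lim at_top
    (\<lambda>T::real. (1 / (2 * T)) *\<^sub>R Bochner_integral lborel (\<lambda>y. indicator {-T..T} y *\<^sub>R f y))"

end

theory Submission
  imports Defs
begin

text \<open>
  No Fourier analysis is needed. For a real almost periodic \<open>g\<close> whose integral over every window
  of length at least \<open>L\<close> is nonpositive, put \<open>h = exp (\<theta> * g)\<close> with small \<open>\<theta> > 0\<close> and take \<open>\<beta>\<close>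
  a large even power of \<open>\<alpha>\<close>. On windows of length \<open>L / \<beta>\<close> the function \<open>h\<close> is nearly constant,
  while functions of \<open>\<beta> * y\<close> already average out there, so the integrals of the products of
  \<open>h (\<beta> ^ j * y)\<close> over \<open>j < J\<close> grow at most like \<open>exp (o(\<theta>) * J)\<close>: the functions \<open>g (\<beta> ^ j * y)\<close>
  behave like independent variables. This exponential moment bound, summed over \<open>J\<close>, makes the
  averages asymptotically nonpositive almost everywhere. Applied to \<open>g - c\<close> with \<open>c\<close> slightly
  above the mean of \<open>g\<close>, and likewise to \<open>- g\<close>, it settles the real case.

  A Banach-valued almost periodic \<open>f\<close> has relatively compact range, so a finite partition of unity
  on that range approximates \<open>f\<close> uniformly by a finite sum of real almost periodic functions times
  fixed vectors.
\<close>

section \<open>Integrals over windows\<close>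

lemma continuous_UNIV_imp_integrable_Icc:
  fixes f :: "real \<Rightarrow> 'a::banach"
  assumes "continuous_on UNIV f"
  shows "f integrable_on {a..b}"
  by (intro integrable_continuous_real continuous_on_subset[OF assms]) simp

lemma continuous_on_window_integral:
  fixes f :: "real \<Rightarrow> 'a::banach"
  assumes f: "continuous_on UNIV f"
  shows "continuous_on UNIV (\<lambda>s. integral {s..s + T} f)"
proof -
  have "continuous_on UNIV (\<lambda>s. integral (cbox 0 T) (\<lambda>u. f (s + u)))"
    by (intro integral_continuous_on_param)
       (auto simp: case_prod_unfold intro!: continuous_on_compose2[OF f] continuous_intros)
  moreover have "integral (cbox 0 T) (\<lambda>u. f (s + u)) = integral {s..s + T} f" for s
    using integral_shift_Icc_real[of 0 T f s] by (simp add: o_def add.commute)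
  ultimately show ?thesis by simp
qed

lemma integral_window_integrals_swap:
  fixes f :: "real \<Rightarrow> 'a::banach"
  assumes f: "continuous_on UNIV f"
  shows "integral {a..a + S} (\<lambda>s. integral {s..s + T} f)
    = integral {a..a + T} (\<lambda>t. integral {t..t + S} f)"
proof -
  have shift: "integral {b..c} (\<lambda>y. h (x + y)) = integral {b + x..c + x} h"
    for b c x and h :: "real \<Rightarrow> 'a"
    using integral_shift_Icc_real[of b c h x] by (simp add: o_def)
  have "integral {a..a + S} (\<lambda>s. integral {s..s + T} f)
      = integral {a..a + S} (\<lambda>s. integral {0..T} (\<lambda>u. f (s + u)))"
    by (simp add: shift add.commute)
  also have "\<dots> = integral {0..T} (\<lambda>u. integral {a..a + S} (\<lambda>s. f (u + s)))"
    using integral_swap_continuous[of a 0 "a + S" T "\<lambda>s u. f (u + s)"]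
    by (simp add: case_prod_unfold add.commute continuous_on_compose2[OF f] continuous_intros)
  also have "\<dots> = integral {0..T} (\<lambda>u. integral {a + u..a + u + S} f)"
    by (simp add: shift add.commute add.left_commute)
  also have "\<dots> = integral {a..a + T} (\<lambda>t. integral {t..t + S} f)"
    using shift[of 0 T "\<lambda>t. integral {t..t + S} f" a] by (simp add: add.commute)
  finally show ?thesis .
qed

lemma integral_le_integral_window_averages:
  fixes f :: "real \<Rightarrow> real"
  assumes f: "continuous_on UNIV f" and f_nonneg: "\<And>x. f x \<ge> 0" and "\<delta> \<ge> 0"
  shows "\<delta> * integral {c..d} f \<le> integral {c - \<delta>..d} (\<lambda>y. integral {y..y + \<delta>} f)"
proof -
  define T where "T = d - c + \<delta>"
  have "\<delta> * integral {c..d} f = integral {c - \<delta>..c - \<delta> + \<delta>} (\<lambda>_. integral {c..d} f)"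
    using \<open>\<delta> \<ge> 0\<close> by simp
  also have "\<dots> \<le> integral {c - \<delta>..c - \<delta> + \<delta>} (\<lambda>s. integral {s..s + T} f)"
    by (intro integral_le continuous_UNIV_imp_integrable_Icc continuous_on_const
        continuous_on_window_integral f integral_subset_le)
       (auto simp: T_def f_nonneg)
  also have "\<dots> = integral {c - \<delta>..d} (\<lambda>y. integral {y..y + \<delta>} f)"
    using integral_window_integrals_swap[OF f, of "c - \<delta>" \<delta> T] by (simp add: T_def)
  finally show ?thesis .
qed

section \<open>Exponential moments of lacunary sums\<close>

text \<open>
  Averaging over translations by at most \<open>L / \<beta>\<close> changes \<open>h\<close> by a factor of at most \<open>e\<close>, while
  \<open>R (\<beta> * y)\<close> runs through a whole window of length \<open>L\<close>.
\<close>

lemma integral_mult_dilated_le: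
  fixes h R :: "real \<Rightarrow> real"
  assumes h: "continuous_on UNIV h" and R: "continuous_on UNIV R"
    and h_nonneg: "\<And>x. h x \<ge> 0" and R_nonneg: "\<And>x. R x \<ge> 0"
    and "L > 0" "\<beta> > 0" "e \<ge> 0"
    and h_near: "\<And>x y. \<bar>x - y\<bar> \<le> L / \<beta> \<Longrightarrow> h x \<le> e * h y"
    and R_window: "\<And>c. integral {c..c + L} R \<le> L * A"
  shows "integral {c..d} (\<lambda>y. h y * R (\<beta> * y)) \<le> e * A * integral {c - L / \<beta>..d} h"
proof -
  define \<delta> where "\<delta> = L / \<beta>"
  have "\<delta> > 0" using \<open>L > 0\<close> \<open>\<beta> > 0\<close> by (simp add: \<delta>_def)
  have R_dilated: "continuous_on UNIV (\<lambda>y. R (\<beta> * y))"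
    by (intro continuous_on_compose2[OF R] continuous_intros) auto
  note product_cont = continuous_on_mult[OF h R_dilated]
  have window: "integral {y..y + \<delta>} (\<lambda>z. h z * R (\<beta> * z)) \<le> \<delta> * (e * A * h y)" for y
  proof -
    have "integral {y..y + \<delta>} (\<lambda>z. h z * R (\<beta> * z)) \<le> integral {y..y + \<delta>} (\<lambda>z. e * h y * R (\<beta> * z))"
      using R_nonneg
      by (intro integral_le continuous_UNIV_imp_integrable_Icc product_cont continuous_intros
          R_dilated mult_right_mono h_near) (auto simp: \<delta>_def)
    also have "\<dots> = e * h y * (integral {\<beta> * y..\<beta> * y + L} R / \<beta>)"
      using integral_stretch_real[of \<beta> "\<beta> * y" "\<beta> * y + L" R] \<open>\<beta> > 0\<close>
      by (simp add: \<delta>_def add_divide_distrib)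
    also have "\<dots> \<le> e * h y * (L * A / \<beta>)"
      using \<open>\<beta> > 0\<close> \<open>e \<ge> 0\<close> h_nonneg by (intro mult_left_mono divide_right_mono R_window) auto
    finally show ?thesis by (simp add: \<delta>_def algebra_simps)
  qed
  have "\<delta> * integral {c..d} (\<lambda>y. h y * R (\<beta> * y))
      \<le> integral {c - \<delta>..d} (\<lambda>y. integral {y..y + \<delta>} (\<lambda>z. h z * R (\<beta> * z)))"
    using h_nonneg R_nonneg \<open>\<delta> > 0\<close>
    by (intro integral_le_integral_window_averages product_cont) auto
  also have "\<dots> \<le> integral {c - \<delta>..d} (\<lambda>y. \<delta> * (e * A * h y))"
    by (intro integral_le window continuous_UNIV_imp_integrable_Icc continuous_on_window_integral
        product_cont continuous_intros h)
  also have "\<dots> = \<delta> * (e * A * integral {c - \<delta>..d} h)" by simp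
  finally have "integral {c..d} (\<lambda>y. h y * R (\<beta> * y)) \<le> e * A * integral {c - \<delta>..d} h"
    using \<open>\<delta> > 0\<close> by (rule mult_left_le_imp_le)
  then show ?thesis by (simp add: \<delta>_def)
qed

lemma integral_lacunary_product_le:
  fixes h :: "real \<Rightarrow> real"
  assumes h: "continuous_on UNIV h" and h_nonneg: "\<And>x. h x \<ge> 0"
    and "L > 0" "\<beta> > 0" "e \<ge> 0" "H \<ge> 0"
    and h_near: "\<And>x y. \<bar>x - y\<bar> \<le> L / \<beta> \<Longrightarrow> h x \<le> e * h y"
    and h_window: "\<And>c M. M \<ge> L \<Longrightarrow> integral {c..c + M} h \<le> M * H"
  shows "integral {c..c + L} (\<lambda>y. \<Prod>j<J. h (\<beta> ^ j * y)) \<le> L * (e * (1 + 1 / \<beta>) * H) ^ J"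
proof (induction J arbitrary: c)
  case 0
  then show ?case using \<open>L > 0\<close> by simp
next
  case (Suc J)
  define R where "R y = (\<Prod>j<J. h (\<beta> ^ j * y))" for y
  let ?A = "(e * (1 + 1 / \<beta>) * H) ^ J"
  have "?A \<ge> 0" using assms by simp
  have "(\<Prod>j<Suc J. h (\<beta> ^ j * y)) = h y * R (\<beta> * y)" for y
    unfolding R_def by (subst prod.lessThan_Suc_shift) (simp add: mult_ac)
  moreover have "integral {c..c + L} (\<lambda>y. h y * R (\<beta> * y)) \<le> e * ?A * integral {c - L / \<beta>..c + L} h"
    using h h_nonneg \<open>L > 0\<close> \<open>\<beta> > 0\<close> \<open>e \<ge> 0\<close> h_near Suc.IH unfolding R_def
    by (intro integral_mult_dilated_le)
       (auto intro!: continuous_intros continuous_on_compose2[OF h] prod_nonneg)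
  moreover have "\<dots> \<le> e * ?A * ((L + L / \<beta>) * H)"
    using h_window[of "L + L / \<beta>" "c - L / \<beta>"] \<open>L > 0\<close> \<open>\<beta> > 0\<close> \<open>e \<ge> 0\<close> \<open>?A \<ge> 0\<close>
    by (intro mult_left_mono) auto
  moreover have "\<dots> = L * (e * (1 + 1 / \<beta>) * H) ^ Suc J" by (simp add: algebra_simps)
  ultimately show ?case by simp
qed

lemma exp_le_one_add_square:
  fixes x :: real
  assumes "\<bar>x\<bar> \<le> 1"
  shows "exp x \<le> 1 + x + x\<^sup>2"
proof (cases "x \<ge> 0")
  case True
  then show ?thesis using exp_bound[of x] assms by auto
next
  case False
  have "x ^ 3 \<le> 0" using False by (simp add: power_le_zero_eq)
  then have "1 \<le> (1 + x + x\<^sup>2) * (1 - x)"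
    by (simp add: algebra_simps power2_eq_square power3_eq_cube)
  also have "\<dots> \<le> (1 + x + x\<^sup>2) * exp (- x)"
    using exp_ge_add_one_self[of "-x"] assms by (intro mult_left_mono) (auto simp: abs_le_iff)
  finally show ?thesis by (simp add: exp_minus field_simps)
qed

lemma integral_exp_le:
  fixes g :: "real \<Rightarrow> real"
  assumes g: "continuous_on UNIV g" and g_bound: "\<And>x. \<bar>g x\<bar> \<le> D"
    and "\<theta> \<ge> 0" "\<theta> * D \<le> 1" "M \<ge> 0" and mean_nonpos: "integral {c..c + M} g \<le> 0"
  shows "integral {c..c + M} (\<lambda>x. exp (\<theta> * g x)) \<le> M * exp ((\<theta> * D)\<^sup>2)"
proof -
  have "exp (\<theta> * g x) \<le> \<theta> * g x + (1 + (\<theta> * D)\<^sup>2)" for x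
  proof -
    have "\<bar>\<theta> * g x\<bar> \<le> \<theta> * D"
      using g_bound[of x] \<open>\<theta> \<ge> 0\<close> by (simp add: abs_mult mult_left_mono)
    then have "(\<theta> * g x)\<^sup>2 \<le> (\<theta> * D)\<^sup>2" and "\<bar>\<theta> * g x\<bar> \<le> 1"
      using \<open>\<theta> * D \<le> 1\<close> by (auto simp flip: abs_le_square_iff)
    with exp_le_one_add_square[of "\<theta> * g x"] show ?thesis by linarith
  qed
  then have "integral {c..c + M} (\<lambda>x. exp (\<theta> * g x))
      \<le> integral {c..c + M} (\<lambda>x. \<theta> * g x + (1 + (\<theta> * D)\<^sup>2))"
    by (intro integral_le continuous_UNIV_imp_integrable_Icc continuous_intros g) auto
  also have "\<dots> = \<theta> * integral {c..c + M} g + M * (1 + (\<theta> * D)\<^sup>2)"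
    using \<open>M \<ge> 0\<close>
    by (subst integral_add) (auto intro!: continuous_UNIV_imp_integrable_Icc continuous_intros g)
  also have "\<dots> \<le> M * (1 + (\<theta> * D)\<^sup>2)"
    using mean_nonpos \<open>\<theta> \<ge> 0\<close> by (simp add: mult_nonneg_nonpos)
  also have "\<dots> \<le> M * exp ((\<theta> * D)\<^sup>2)"
    using \<open>M \<ge> 0\<close> by (intro mult_left_mono exp_ge_add_one_self)
  finally show ?thesis .
qed

lemma exists_small_exponential_moment:
  fixes g :: "real \<Rightarrow> real"
  assumes g: "continuous_on UNIV g" and "bounded (range g)" and "\<epsilon> > 0"
  shows "\<exists>\<theta>>0. \<forall>c M. M \<ge> 0 \<longrightarrow> integral {c..c + M} g \<le> 0 \<longrightarrow>
    integral {c..c + M} (\<lambda>x. exp (\<theta> * g x)) \<le> M * exp (\<theta> * \<epsilon>)"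
proof -
  obtain D where "D > 0" and D: "\<And>x. \<bar>g x\<bar> \<le> D"
    using \<open>bounded (range g)\<close> by (auto simp: bounded_pos)
  define \<theta> where "\<theta> = min (1 / D) (\<epsilon> / D\<^sup>2)"
  have "\<theta> > 0" using \<open>D > 0\<close> \<open>\<epsilon> > 0\<close> by (simp add: \<theta>_def)
  have "\<theta> \<le> 1 / D" "\<theta> \<le> \<epsilon> / D\<^sup>2" by (simp_all add: \<theta>_def)
  then have "\<theta> * D \<le> 1" "\<theta> * D\<^sup>2 \<le> \<epsilon>" using \<open>D > 0\<close> by (simp_all add: pos_le_divide_eq)
  then have "(\<theta> * D)\<^sup>2 \<le> \<theta> * \<epsilon>"
    using \<open>\<theta> > 0\<close> by (simp add: power_mult_distrib power2_eq_square[of \<theta>] mult.assoc)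
  have "integral {c..c + M} (\<lambda>x. exp (\<theta> * g x)) \<le> M * exp (\<theta> * \<epsilon>)"
    if "M \<ge> 0" "integral {c..c + M} g \<le> 0" for c M
  proof -
    have "integral {c..c + M} (\<lambda>x. exp (\<theta> * g x)) \<le> M * exp ((\<theta> * D)\<^sup>2)"
      using \<open>\<theta> > 0\<close> \<open>\<theta> * D \<le> 1\<close> that by (intro integral_exp_le g D) auto
    also have "\<dots> \<le> M * exp (\<theta> * \<epsilon>)"
      using \<open>(\<theta> * D)\<^sup>2 \<le> \<theta> * \<epsilon>\<close> \<open>M \<ge> 0\<close> by (intro mult_left_mono) auto
    finally show ?thesis .
  qed
  with \<open>\<theta> > 0\<close> show ?thesis by blast
qed

lemma uniformly_continuous_imp_exp_le:
  fixes f :: "'a::metric_space \<Rightarrow> real"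
  assumes f: "uniformly_continuous_on UNIV f" and "\<eta> > 0"
  obtains \<delta> where "\<delta> > 0" "\<And>x y. dist x y < \<delta> \<Longrightarrow> exp (f x) \<le> exp \<eta> * exp (f y)"
proof -
  obtain \<delta> where "\<delta> > 0" and near: "\<And>x y. dist x y < \<delta> \<Longrightarrow> dist (f x) (f y) < \<eta>"
    using f \<open>\<eta> > 0\<close> by (rule uniformly_continuous_onE) blast
  have "exp (f x) \<le> exp \<eta> * exp (f y)" if "dist x y < \<delta>" for x y
    using near[OF that] by (simp add: dist_real_def flip: exp_add)
  with \<open>\<delta> > 0\<close> show thesis by (rule that)
qed

lemma integral_exp_lacunary_sum_le:
  fixes g :: "real \<Rightarrow> real"
  assumes g: "uniformly_continuous_on UNIV g" and g_bounded: "bounded (range g)" and "L > 0"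
    and mean_nonpos: "\<And>c M. M \<ge> L \<Longrightarrow> integral {c..c + M} g \<le> 0" and "\<epsilon> > 0"
  shows "\<exists>\<theta>>0. \<exists>\<beta>0. \<forall>\<beta>\<ge>\<beta>0. \<forall>c J.
    integral {c..c + L} (\<lambda>y. exp (\<theta> * (\<Sum>j<J. g (\<beta> ^ j * y)))) \<le> L * exp (\<theta> * \<epsilon>) ^ J"
proof -
  have g_cont: "continuous_on UNIV g" using g by (rule uniformly_continuous_imp_continuous)
  obtain \<theta> where "\<theta> > 0" and moment: "\<And>c M. M \<ge> 0 \<Longrightarrow> integral {c..c + M} g \<le> 0 \<Longrightarrow>
      integral {c..c + M} (\<lambda>x. exp (\<theta> * g x)) \<le> M * exp (\<theta> * (\<epsilon> / 3))"
    using exists_small_exponential_moment[OF g_cont g_bounded, of "\<epsilon> / 3"] \<open>\<epsilon> > 0\<close> by auto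
  define h where "h x = exp (\<theta> * g x)" for x
  define \<eta> where "\<eta> = \<theta> * (\<epsilon> / 3)"
  have "\<eta> > 0" using \<open>\<theta> > 0\<close> \<open>\<epsilon> > 0\<close> by (simp add: \<eta>_def)
  have "uniformly_continuous_on UNIV (\<lambda>x. \<theta> * g x)"
    using uniformly_continuous_on_cmul[OF g, of \<theta>] by simp
  then obtain \<delta> where "\<delta> > 0" and h_near: "\<And>x y. dist x y < \<delta> \<Longrightarrow> h x \<le> exp \<eta> * h y"
    using \<open>\<eta> > 0\<close> unfolding h_def by (rule uniformly_continuous_imp_exp_le) blast
  have "integral {c..c + L} (\<lambda>y. exp (\<theta> * (\<Sum>j<J. g (\<beta> ^ j * y)))) \<le> L * exp (\<theta> * \<epsilon>) ^ J"
    if \<beta>: "\<beta> \<ge> max (2 * L / \<delta>) (1 / \<eta>)" for \<beta> c J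
  proof -
    have "1 / \<eta> > 0" using \<open>\<eta> > 0\<close> by simp
    with \<beta> have "\<beta> > 0" by linarith
    with \<beta> have "L / \<beta> < \<delta>" "1 / \<beta> \<le> \<eta>"
      using \<open>\<delta> > 0\<close> \<open>\<eta> > 0\<close> \<open>L > 0\<close> by (auto simp: field_simps)
    have "integral {c..c + L} (\<lambda>y. \<Prod>j<J. h (\<beta> ^ j * y)) \<le> L * (exp \<eta> * (1 + 1 / \<beta>) * exp \<eta>) ^ J"
      using \<open>L > 0\<close> \<open>\<beta> > 0\<close> \<open>L / \<beta> < \<delta>\<close> mean_nonpos moment h_near
      by (intro integral_lacunary_product_le)
         (auto simp: h_def \<eta>_def dist_real_def intro!: continuous_intros g_cont)
    also have "\<dots> \<le> L * (exp \<eta> * exp \<eta> * exp \<eta>) ^ J"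
      using exp_ge_add_one_self[of \<eta>] \<open>1 / \<beta> \<le> \<eta>\<close> \<open>\<beta> > 0\<close> \<open>L > 0\<close>
      by (intro mult_left_mono power_mono mult_right_mono) (auto simp del: exp_ge_add_one_self)
    also have "exp \<eta> * exp \<eta> * exp \<eta> = exp (\<theta> * \<epsilon>)" by (simp add: \<eta>_def flip: exp_add)
    finally show ?thesis by (simp add: h_def sum_distrib_left exp_sum)
  qed
  with \<open>\<theta> > 0\<close> show ?thesis by blast
qed

section \<open>Almost sure bounds along orbits\<close>

lemma AE_on_blocks_imp_AE_lborel:
  assumes "L > 0" and "\<And>c. AE x in lborel. x \<in> {c..c + L} \<longrightarrow> P x"
  shows "AE x::real in lborel. P x"
proof -
  have "AE x in lborel. \<forall>k::int. x \<in> {of_int k * L..of_int k * L + L} \<longrightarrow> P x"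
    using assms(2) by (subst AE_all_countable) auto
  then show ?thesis
  proof eventually_elim
    case (elim x)
    have "of_int \<lfloor>x / L\<rfloor> * L \<le> x" "x \<le> (of_int \<lfloor>x / L\<rfloor> + 1) * L"
      using floor_divide_lower[OF \<open>L > 0\<close>] floor_divide_upper[OF \<open>L > 0\<close>]
      by (auto intro: less_imp_le)
    then have "x \<in> {of_int \<lfloor>x / L\<rfloor> * L..of_int \<lfloor>x / L\<rfloor> * L + L}"
      by (auto simp: algebra_simps)
    with elim show ?case by blast
  qed
qed

lemma AE_tendsto_zero_if_summable_integrals:
  fixes Q :: "nat \<Rightarrow> real \<Rightarrow> real"
  assumes Q: "\<And>J. continuous_on UNIV (Q J)" and Q_nonneg: "\<And>J x. Q J x \<ge> 0"
    and summable: "summable (\<lambda>J. integral {a..b} (Q J))"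
  shows "AE x in lborel. x \<in> {a..b} \<longrightarrow> (\<lambda>J. Q J x) \<longlonglongrightarrow> 0"
proof -
  have meas: "(\<lambda>x. ennreal (Q J x) * indicator {a..b} x) \<in> borel_measurable lborel" for J
    using borel_measurable_continuous_onI[OF Q[of J]] by measurable
  have "(\<integral>\<^sup>+x. (\<Sum>J. ennreal (Q J x) * indicator {a..b} x) \<partial>lborel)
      = (\<Sum>J. \<integral>\<^sup>+x. ennreal (Q J x) * indicator {a..b} x \<partial>lborel)"
    by (intro nn_integral_suminf meas)
  also have "\<dots> = (\<Sum>J. ennreal (integral {a..b} (Q J)))"
    using continuous_UNIV_imp_integrable_Icc[OF Q] Q_nonneg
    by (intro arg_cong[where f = suminf] ext nn_integral_has_integral_lebesgue')
       (auto simp: has_integral_integral)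
  also have "\<dots> = ennreal (\<Sum>J. integral {a..b} (Q J))"
    using summable Q_nonneg
    by (intro suminf_ennreal2 integral_nonneg continuous_UNIV_imp_integrable_Icc Q)
  also have "\<dots> \<noteq> \<infinity>" by simp
  finally have "AE x in lborel. (\<Sum>J. ennreal (Q J x) * indicator {a..b} x) \<noteq> \<infinity>"
    by (intro nn_integral_PInf_AE borel_measurable_suminf_order meas)
  then show ?thesis
  proof eventually_elim
    case (elim x)
    show ?case
    proof
      assume "x \<in> {a..b}"
      with elim have "(\<Sum>J. ennreal (Q J x)) \<noteq> top" by simp
      then have "summable (\<lambda>J. Q J x)" using Q_nonneg by (intro summable_suminf_not_top) auto
      then show "(\<lambda>J. Q J x) \<longlonglongrightarrow> 0" by (rule summable_LIMSEQ_zero)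
    qed
  qed
qed

lemma AE_eventually_le_if_exponential_moments:
  fixes S :: "nat \<Rightarrow> real \<Rightarrow> real"
  assumes S: "\<And>J. continuous_on UNIV (S J)" and "L > 0" "\<theta> > 0" "\<epsilon> < \<epsilon>'"
    and moments: "\<And>c J. integral {c..c + L} (\<lambda>y. exp (\<theta> * S J y)) \<le> L * exp (\<theta> * \<epsilon>) ^ J"
  shows "AE x in lborel. \<forall>\<^sub>F J in sequentially. S J x \<le> \<epsilon>' * real J"
proof -
  define Q where "Q J = (\<lambda>x. exp (- (\<theta> * \<epsilon>')) ^ J * exp (\<theta> * S J x))" for J
  define q where "q = exp (- (\<theta> * \<epsilon>')) * exp (\<theta> * \<epsilon>)"
  have Q: "continuous_on UNIV (Q J)" for J unfolding Q_def by (intro continuous_intros S)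
  have "0 \<le> q" "q < 1" using \<open>\<theta> > 0\<close> \<open>\<epsilon> < \<epsilon>'\<close> by (simp_all add: q_def flip: exp_add)
  have Q_integral: "norm (integral {c..c + L} (Q J)) \<le> L * q ^ J" for c J
  proof -
    have "exp (- (\<theta> * \<epsilon>')) ^ J * integral {c..c + L} (\<lambda>y. exp (\<theta> * S J y))
        \<le> exp (- (\<theta> * \<epsilon>')) ^ J * (L * exp (\<theta> * \<epsilon>) ^ J)"
      by (intro mult_left_mono moments) simp
    moreover have "integral {c..c + L} (Q J) \<ge> 0"
      by (intro integral_nonneg continuous_UNIV_imp_integrable_Icc Q) (simp add: Q_def)
    ultimately show ?thesis by (simp add: Q_def q_def power_mult_distrib mult.left_commute)
  qed
  have "summable (\<lambda>J. integral {c..c + L} (Q J))" for c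
    using \<open>0 \<le> q\<close> \<open>q < 1\<close>
    by (intro summable_comparison_test'[OF _ Q_integral] summable_mult summable_geometric) auto
  then have "AE x in lborel. x \<in> {c..c + L} \<longrightarrow> (\<lambda>J. Q J x) \<longlonglongrightarrow> 0" for c
    by (intro AE_tendsto_zero_if_summable_integrals Q) (simp_all add: Q_def)
  from AE_on_blocks_imp_AE_lborel[OF \<open>L > 0\<close> this] show ?thesis
  proof eventually_elim
    case (elim x)
    then have "\<forall>\<^sub>F J in sequentially. Q J x < 1" by (rule order_tendstoD) simp
    then show ?case
    proof eventually_elim
      case (elim J)
      have "Q J x = exp (\<theta> * (S J x - \<epsilon>' * real J))"
        by (simp add: Q_def algebra_simps flip: exp_of_nat_mult exp_add)
      with elim show ?case using \<open>\<theta> > 0\<close> by (simp add: mult_less_0_iff)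
    qed
  qed
qed

lemma AE_lacunary_sum_le:
  fixes g :: "real \<Rightarrow> real"
  assumes g: "uniformly_continuous_on UNIV g" and g_bounded: "bounded (range g)" and "L > 0"
    and mean_nonpos: "\<And>c M. M \<ge> L \<Longrightarrow> integral {c..c + M} g \<le> 0" and "\<epsilon> > 0"
  shows "\<exists>\<beta>0. \<forall>\<beta>\<ge>\<beta>0. AE x in lborel. \<forall>\<^sub>F J in sequentially. (\<Sum>j<J. g (\<beta> ^ j * x)) \<le> \<epsilon> * real J"
proof -
  obtain \<theta> \<beta>0 where "\<theta> > 0" and moments: "\<And>\<beta> c J. \<beta> \<ge> \<beta>0 \<Longrightarrow>
      integral {c..c + L} (\<lambda>y. exp (\<theta> * (\<Sum>j<J. g (\<beta> ^ j * y)))) \<le> L * exp (\<theta> * (\<epsilon> / 2)) ^ J"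
    using integral_exp_lacunary_sum_le[OF g g_bounded \<open>L > 0\<close> mean_nonpos half_gt_zero[OF \<open>\<epsilon> > 0\<close>]]
    by blast
  have g_cont: "continuous_on UNIV g" using g by (rule uniformly_continuous_imp_continuous)
  have sum_cont: "continuous_on UNIV (\<lambda>x. \<Sum>j<J. g (\<beta> ^ j * x))" for \<beta> J
    by (intro continuous_intros continuous_on_compose2[OF g_cont]) auto
  have "AE x in lborel. \<forall>\<^sub>F J in sequentially. (\<Sum>j<J. g (\<beta> ^ j * x)) \<le> \<epsilon> * real J"
    if "\<beta> \<ge> \<beta>0" for \<beta>
    using \<open>L > 0\<close> \<open>\<theta> > 0\<close> _ moments[OF that]
    by (rule AE_eventually_le_if_exponential_moments[OF sum_cont]) (use \<open>\<epsilon> > 0\<close> in simp)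
  then show ?thesis by blast
qed

lemma AE_lebesgue_scale:
  assumes "AE x::real in lebesgue. P x" and "c \<noteq> 0"
  shows "AE x in lebesgue. P (c * x)"
proof -
  obtain N where N: "negligible N" "{x. \<not> P x} \<subseteq> N"
    using assms(1) unfolding eventually_ae_filter_negligible by blast
  have "negligible ((\<lambda>x. x / c) ` N)"
    using N(1) by (rule negligible_differentiable_image_negligible[OF order_refl])
      (auto intro!: linear_imp_differentiable_on bounded_linear.linear[OF bounded_linear_divide])
  moreover have "{x. \<not> P (c * x)} \<subseteq> (\<lambda>x. x / c) ` N"
    using N(2) \<open>c \<noteq> 0\<close> by (force intro!: image_eqI[where x = "c * _"])
  ultimately show ?thesis
    unfolding eventually_ae_filter_negligible by blast
qed

lemma eventually_sum_le_if_residue_classes: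
  fixes G :: "nat \<Rightarrow> real"
  assumes "p > 0" and "bounded (range G)" and "0 < \<epsilon>"
    and classes: "\<And>r. r < p \<Longrightarrow> \<forall>\<^sub>F J in sequentially. (\<Sum>j<J. G (r + j * p)) \<le> \<epsilon> * real J"
  shows "\<forall>\<^sub>F N in sequentially. (\<Sum>n<N. G n) \<le> 2 * \<epsilon> * real N"
proof -
  obtain B where B: "\<And>n. \<bar>G n\<bar> \<le> B" using \<open>bounded (range G)\<close> by (auto simp: bounded_iff)
  have "B \<ge> 0" using B[of 0] by simp
  have "\<forall>\<^sub>F J in sequentially. \<forall>r\<in>{..<p}. (\<Sum>j<J. G (r + j * p)) \<le> \<epsilon> * real J"
    using classes by (intro eventually_ball_finite) auto
  then have "\<forall>\<^sub>F N in sequentially. \<forall>r\<in>{..<p}. (\<Sum>j<N div p. G (r + j * p)) \<le> \<epsilon> * real (N div p)"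
    by (rule eventually_compose_filterlim) (rule filterlim_at_top_div_const_nat[OF \<open>p > 0\<close>])
  moreover have "\<forall>\<^sub>F N in sequentially. real N \<ge> real p * B / \<epsilon>"
    using filterlim_real_sequentially by (simp add: filterlim_at_top)
  ultimately show ?thesis
  proof eventually_elim
    case (elim N)
    define J where "J = N div p"
    have J: "J * p \<le> N" "N - J * p \<le> p"
      using \<open>p > 0\<close> dividend_less_div_times[of p N] by (auto simp: J_def)
    have "(\<Sum>n<J * p. G n) = (\<Sum>r<p. \<Sum>j<J. G (r + j * p))"
      unfolding sum_mult_product by (rule sum.swap)
    also have "\<dots> \<le> (\<Sum>r<p. \<epsilon> * real J)" using elim(1) by (intro sum_mono) (auto simp: J_def)
    also have "\<dots> = \<epsilon> * real (J * p)" by simp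
    also have "\<dots> \<le> \<epsilon> * real N" using J(1) \<open>\<epsilon> > 0\<close> by (intro mult_left_mono) linarith+
    finally have full_blocks: "(\<Sum>n<J * p. G n) \<le> \<epsilon> * real N" .
    have "(\<Sum>n\<in>{J * p..<N}. G n) \<le> (\<Sum>n\<in>{J * p..<N}. B)"
      using B by (intro sum_mono) (auto simp: abs_le_iff)
    also have "\<dots> \<le> real p * B" using J(2) \<open>B \<ge> 0\<close> by (simp add: mult_right_mono)
    also have "\<dots> \<le> \<epsilon> * real N" using elim(2) \<open>\<epsilon> > 0\<close> by (simp add: field_simps)
    finally have remainder: "(\<Sum>n\<in>{J * p..<N}. G n) \<le> \<epsilon> * real N" .
    have "(\<Sum>n<N. G n) = (\<Sum>n<J * p. G n) + (\<Sum>n\<in>{J * p..<N}. G n)"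
      using J(1) by (simp add: lessThan_atLeast0 sum.atLeastLessThan_concat)
    with full_blocks remainder show ?case by simp
  qed
qed

lemma AE_orbit_sum_le:
  fixes g :: "real \<Rightarrow> real"
  assumes g: "uniformly_continuous_on UNIV g" and g_bounded: "bounded (range g)" and "L > 0"
    and mean_nonpos: "\<And>c M. M \<ge> L \<Longrightarrow> integral {c..c + M} g \<le> 0" and "\<epsilon> > 0" and "\<bar>\<alpha>\<bar> > 1"
  shows "AE x in lebesgue. \<forall>\<^sub>F N in sequentially. (\<Sum>n<N. g (\<alpha> ^ n * x)) \<le> \<epsilon> * real N"
proof -
  obtain \<beta>0 where \<beta>0: "\<And>\<beta>. \<beta> \<ge> \<beta>0 \<Longrightarrow>
      AE x in lborel. \<forall>\<^sub>F J in sequentially. (\<Sum>j<J. g (\<beta> ^ j * x)) \<le> \<epsilon> / 2 * real J"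
    using AE_lacunary_sum_le[OF g g_bounded \<open>L > 0\<close> mean_nonpos, of "\<epsilon> / 2"] \<open>\<epsilon> > 0\<close> by auto
  \<comment> \<open>an even exponent makes \<open>\<alpha> ^ p\<close> positive for negative \<open>\<alpha>\<close>\<close>
  obtain p where "p > 0" "\<alpha> ^ p \<ge> \<beta>0"
  proof -
    have "\<alpha>\<^sup>2 > 1" using \<open>\<bar>\<alpha>\<bar> > 1\<close> one_less_power[of "\<bar>\<alpha>\<bar>" 2] by simp
    then obtain k where k: "max \<beta>0 1 < (\<alpha>\<^sup>2) ^ k" using real_arch_pow by blast
    then have "k \<noteq> 0" by (intro notI) simp
    with k show thesis by (intro that[of "2 * k"]) (simp_all add: power_mult)
  qed
  have "AE x in lebesgue. \<forall>\<^sub>F J in sequentially. (\<Sum>j<J. g ((\<alpha> ^ p) ^ j * x)) \<le> \<epsilon> / 2 * real J"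
    using \<beta>0[OF \<open>\<alpha> ^ p \<ge> \<beta>0\<close>] by (rule AE_completion)
  then have "AE x in lebesgue. \<forall>\<^sub>F J in sequentially.
      (\<Sum>j<J. g ((\<alpha> ^ p) ^ j * (\<alpha> ^ r * x))) \<le> \<epsilon> / 2 * real J" for r
    using \<open>\<bar>\<alpha>\<bar> > 1\<close> by (intro AE_lebesgue_scale) auto
  then have "AE x in lebesgue. \<forall>r. \<forall>\<^sub>F J in sequentially.
      (\<Sum>j<J. g ((\<alpha> ^ p) ^ j * (\<alpha> ^ r * x))) \<le> \<epsilon> / 2 * real J"
    by (simp add: AE_all_countable)
  then show ?thesis
  proof eventually_elim
    case (elim x)
    have "\<forall>\<^sub>F J in sequentially. (\<Sum>j<J. g (\<alpha> ^ (r + j * p) * x)) \<le> \<epsilon> / 2 * real J" for r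
      using spec[OF elim, of r] by (simp add: power_add mult_ac flip: power_mult)
    moreover have "bounded (range (\<lambda>n. g (\<alpha> ^ n * x)))"
      using g_bounded by (rule bounded_subset) auto
    ultimately show ?case
      using eventually_sum_le_if_residue_classes[OF \<open>p > 0\<close>, of "\<lambda>n. g (\<alpha> ^ n * x)" "\<epsilon> / 2"] \<open>\<epsilon> > 0\<close>
      by simp
  qed
qed

definition window_mean :: "(real \<Rightarrow> 'a::real_normed_vector) \<Rightarrow> real \<Rightarrow> real \<Rightarrow> 'a" where
  "window_mean f a L = integral {a..a + L} f /\<^sub>R L"

definition orbit_average :: "real \<Rightarrow> (real \<Rightarrow> 'a::real_vector) \<Rightarrow> real \<Rightarrow> nat \<Rightarrow> 'a" where
  "orbit_average \<alpha> f x N = (1 / real N) *\<^sub>R (\<Sum>n<N. f (\<alpha> ^ n * x))"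

lemma AE_orbit_average_le:
  fixes g :: "real \<Rightarrow> real"
  assumes g: "uniformly_continuous_on UNIV g" and g_bounded: "bounded (range g)" and "L > 0"
    and g_window: "\<And>c M. M \<ge> L \<Longrightarrow> window_mean g c M \<le> m" and "\<epsilon> > 0" and "\<bar>\<alpha>\<bar> > 1"
  shows "AE x in lebesgue. \<forall>\<^sub>F N in sequentially. orbit_average \<alpha> g x N \<le> m + \<epsilon>"
proof -
  have "AE x in lebesgue. \<forall>\<^sub>F N in sequentially. (\<Sum>n<N. g (\<alpha> ^ n * x) - m) \<le> \<epsilon> * real N"
  proof (rule AE_orbit_sum_le)
    show "bounded (range (\<lambda>x. g x - m))"
      using bounded_translation_minus[OF g_bounded, of m] by (simp add: image_image)
    show "integral {c..c + M} (\<lambda>x. g x - m) \<le> 0" if "M \<ge> L" for c M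
    proof -
      have "integral {c..c + M} g \<le> M * m"
        using g_window[OF that, of c] that \<open>L > 0\<close> by (simp add: window_mean_def field_simps)
      then show ?thesis
        using that \<open>L > 0\<close> uniformly_continuous_imp_continuous[OF g]
        by (subst integral_diff) (auto intro!: continuous_UNIV_imp_integrable_Icc)
    qed
  qed (use assms in \<open>auto intro!: uniformly_continuous_on_diff uniformly_continuous_on_const\<close>)
  then show ?thesis
  proof eventually_elim
    case (elim x)
    from elim eventually_gt_at_top[of 0] show ?case
      by eventually_elim (simp add: orbit_average_def sum_subtractf field_simps)
  qed
qed

section \<open>The Bochner integral of a continuous function\<close>

lemma borel_measurable_norm_diff_simple_function:
  fixes f s :: "'a \<Rightarrow> 'b::real_normed_vector"
  assumes f: "f \<in> borel_measurable M" and s: "simple_function M s"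
  shows "(\<lambda>x. norm (f x - s x)) \<in> borel_measurable M"
proof (rule measurable_compose_countable'[where f = "\<lambda>v x. norm (f x - v)" and g = s])
  show "(\<lambda>x. norm (f x - v)) \<in> borel_measurable M" for v
    using f by (rule measurable_compose) (intro borel_measurable_continuous_onI continuous_intros)
  show "s \<in> measurable M (count_space (s ` space M))"
    using simple_functionD[OF s] by (subst measurable_count_space_eq2) auto
  show "countable (s ` space M)"
    using simple_functionD(1)[OF s] by (rule countable_finite)
qed

lemma norm_simple_bochner_integral_diff_le:
  fixes f :: "'a \<Rightarrow> 'b::real_normed_vector"
  assumes f: "f \<in> borel_measurable M"
    and s: "Bochner_Integration.simple_bochner_integrable M s"
    and t: "Bochner_Integration.simple_bochner_integrable M t"
  shows "ennreal (norm (Bochner_Integration.simple_bochner_integral M s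
        - Bochner_Integration.simple_bochner_integral M t))
    \<le> (\<integral>\<^sup>+ x. norm (f x - s x) \<partial>M) + (\<integral>\<^sup>+ x. norm (f x - t x) \<partial>M)"
proof -
  let ?I = "Bochner_Integration.simple_bochner_integral M"
  have meas: "(\<lambda>x. ennreal (norm (f x - u x))) \<in> borel_measurable M"
    if "Bochner_Integration.simple_bochner_integrable M u" for u
    using borel_measurable_norm_diff_simple_function[OF f] that
    by (auto elim: simple_bochner_integrable.cases)
  have "ennreal (norm (?I s - ?I t)) = norm (?I (\<lambda>x. s x - t x))"
    using s t by (subst simple_bochner_integral_diff) auto
  also have "\<dots> \<le> ?I (\<lambda>x. norm (s x - t x))"
    using simple_bochner_integrable_compose2[of "(-)" M s t] s t
    by (auto intro!: simple_bochner_integral_norm_bound)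
  also have "\<dots> = (\<integral>\<^sup>+ x. norm (s x - t x) \<partial>M)"
    using simple_bochner_integrable_compose2[of "\<lambda>x y. norm (x - y)" M s t] s t
    by (auto intro!: simple_bochner_integral_eq_nn_integral)
  also have "\<dots> \<le> (\<integral>\<^sup>+ x. ennreal (norm (f x - s x)) + ennreal (norm (f x - t x)) \<partial>M)"
  proof (intro nn_integral_mono)
    fix x
    have "norm (s x - t x) \<le> norm (f x - s x) + norm (f x - t x)"
      using norm_triangle_ineq4[of "f x - t x" "f x - s x"] by (simp add: add.commute)
    then show "ennreal (norm (s x - t x)) \<le> ennreal (norm (f x - s x)) + ennreal (norm (f x - t x))"
      by (metis ennreal_leI ennreal_plus norm_ge_zero)
  qed
  also have "\<dots> = (\<integral>\<^sup>+ x. norm (f x - s x) \<partial>M) + (\<integral>\<^sup>+ x. norm (f x - t x) \<partial>M)"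
    by (intro nn_integral_add meas s t)
  finally show ?thesis .
qed

lemma has_Bochner_integral_unique:
  assumes "has_Bochner_integral M f x" and "has_Bochner_integral M f y"
  shows "x = y"
  using assms(1)
proof cases
  case s: (1 s)
  from assms(2) show ?thesis
  proof cases
    case t: (1 t)
    let ?I = "Bochner_Integration.simple_bochner_integral M"
    have bound: "(\<lambda>i. (\<integral>\<^sup>+ z. norm (f z - s i z) \<partial>M) + (\<integral>\<^sup>+ z. norm (f z - t i z) \<partial>M)) \<longlonglongrightarrow> 0 + 0"
      using s(3) t(3) by (intro tendsto_add)
    have diff: "(\<lambda>i. ennreal (norm (?I (s i) - ?I (t i)))) \<longlonglongrightarrow> ennreal (norm (x - y))"
      using s(4) t(4) by (intro tendsto_ennrealI tendsto_norm tendsto_diff)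
    have "ennreal (norm (x - y)) \<le> 0 + 0"
      by (rule LIMSEQ_le[OF diff bound])
         (intro exI allI impI norm_simple_bochner_integral_diff_le s t)
    then show ?thesis by simp
  qed
qed

lemma Bochner_integral_eqI:
  assumes "has_Bochner_integral M f x"
  shows "Bochner_integral M f = x"
proof -
  have "(THE y. has_Bochner_integral M f y) = x"
    using assms by (rule the_equality) (rule has_Bochner_integral_unique[OF _ assms])
  with assms show ?thesis unfolding Bochner_integral_def by auto
qed

lemma simple_bochner_integrable_has_integral:
  fixes s :: "real \<Rightarrow> 'a::banach"
  assumes "Bochner_Integration.simple_bochner_integrable lborel s"
  shows "(s has_integral Bochner_Integration.simple_bochner_integral lborel s) UNIV"
proof -
  from assms have s: "simple_function lborel s" and support: "emeasure lborel {x. s x \<noteq> 0} \<noteq> \<infinity>"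
    by (auto elim: simple_bochner_integrable.cases)
  have finite_range: "finite (range s)" using simple_functionD(1)[OF s] by simp
  have level: "((\<lambda>x. if s x = y then y else 0) has_integral measure lborel {x. s x = y} *\<^sub>R y) UNIV"
    for y
  proof (cases "y = 0")
    case False
    have sets: "s -` V \<in> sets lborel" for V
      using simple_functionD(2)[OF s, of V] by simp
    have "emeasure lborel {x. s x = y} \<le> emeasure lborel {x. s x \<noteq> 0}"
      using False sets[of "- {0}"] by (intro emeasure_mono) (auto simp: vimage_def)
    then have "emeasure lborel {x. s x = y} < \<infinity>"
      using support by (simp add: top.not_eq_extremum order.strict_trans1)
    then have "((\<lambda>x. 1) has_integral measure lborel {x. s x = y}) {x. s x = y}"
      using sets[of "{y}"] by (intro has_integral_measure_lborel) (auto simp: vimage_def)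
    from has_integral_scaleR_left[OF this, of y] show ?thesis
      using has_integral_restrict_UNIV[of "{x. s x = y}" "\<lambda>_. y"] by simp
  qed (simp cong: if_cong)
  have "((\<lambda>x. \<Sum>y\<in>range s. if s x = y then y else 0) has_integral
      (\<Sum>y\<in>range s. measure lborel {x. s x = y} *\<^sub>R y)) UNIV"
    by (intro has_integral_sum finite_range level)
  moreover have "(\<Sum>y\<in>range s. if s x = y then y else 0) = s x" for x
    using finite_range by simp
  ultimately show ?thesis
    by (simp add: Bochner_Integration.simple_bochner_integral_def)
qed

lemma continuous_on_Icc_simple_approximation:
  fixes f :: "real \<Rightarrow> 'a::real_normed_vector"
  assumes f: "continuous_on {a..b} f" and "\<eta> > 0"
  obtains s where "Bochner_Integration.simple_bochner_integrable lborel s"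
    "\<And>y. y \<notin> {a..b} \<Longrightarrow> s y = 0" "\<And>y. y \<in> {a..b} \<Longrightarrow> norm (f y - s y) \<le> \<eta>"
proof -
  have "uniformly_continuous_on {a..b} f" by (intro compact_uniformly_continuous f) simp
  then obtain d where "d > 0"
    and near: "\<And>x y. x \<in> {a..b} \<Longrightarrow> y \<in> {a..b} \<Longrightarrow> dist y x < d \<Longrightarrow> dist (f y) (f x) < \<eta>"
    using \<open>\<eta> > 0\<close> by (rule uniformly_continuous_onE) blast
  define k where "k y = \<lfloor>min b (max a y) / d\<rfloor>" for y
  define s where "s y = (if y \<in> {a..b} then f (max a (of_int (k y) * d)) else 0)" for y
  have "range k \<subseteq> {\<lfloor>min a b / d\<rfloor>..\<lfloor>b / d\<rfloor>}"
    using \<open>d > 0\<close> by (auto simp: k_def intro!: floor_mono divide_right_mono)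
  then have "finite (range k)" by (rule finite_subset) simp
  moreover have "k \<in> measurable lborel (count_space UNIV)" unfolding k_def by measurable
  ultimately have "simple_function lborel k" by (simp add: simple_function_eq_measurable)
  then have "simple_function lborel (\<lambda>y. f (max a (of_int (k y) * d)))"
    by (rule simple_function_compose1)
  then have "simple_function lborel s"
    unfolding s_def by (intro simple_function_If_set) auto
  moreover have "emeasure lborel {y \<in> space lborel. s y \<noteq> 0} \<le> emeasure lborel {a..b}"
    by (intro emeasure_mono) (auto simp: s_def)
  then have "emeasure lborel {y \<in> space lborel. s y \<noteq> 0} \<noteq> \<infinity>"
    by (auto simp: emeasure_lborel_Icc_eq top_unique split: if_splits)
  ultimately have "Bochner_Integration.simple_bochner_integrable lborel s" ..
  moreover have "norm (f y - s y) \<le> \<eta>" if y: "y \<in> {a..b}" for y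
  proof -
    have "of_int (k y) * d \<le> y" "y < (of_int (k y) + 1) * d"
      using floor_divide_lower[OF \<open>d > 0\<close>, of y] floor_divide_upper[OF \<open>d > 0\<close>, of y] y
      by (auto simp: k_def)
    then have "dist (f y) (f (max a (of_int (k y) * d))) < \<eta>"
      using y by (intro near) (auto simp: dist_real_def algebra_simps max_def)
    then show ?thesis using y by (simp add: s_def dist_norm)
  qed
  ultimately show thesis by (intro that[of s]) (auto simp: s_def)
qed

lemma
  fixes f :: "real \<Rightarrow> 'a::banach"
  assumes f: "continuous_on {a..b} f" and "a \<le> b" and "\<eta> \<ge> 0"
    and s: "Bochner_Integration.simple_bochner_integrable lborel s"
    and support: "\<And>y. y \<notin> {a..b} \<Longrightarrow> s y = 0"
    and close: "\<And>y. y \<in> {a..b} \<Longrightarrow> norm (f y - s y) \<le> \<eta>"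
  shows nn_integral_norm_diff_simple_le:
      "(\<integral>\<^sup>+y. norm (indicator {a..b} y *\<^sub>R f y - s y) \<partial>lborel) \<le> ennreal (\<eta> * (b - a))"
    and norm_simple_bochner_integral_diff_integral_le:
      "norm (Bochner_Integration.simple_bochner_integral lborel s - integral {a..b} f)
        \<le> \<eta> * (b - a)"
proof -
  have "(\<integral>\<^sup>+y. norm (indicator {a..b} y *\<^sub>R f y - s y) \<partial>lborel)
      \<le> (\<integral>\<^sup>+y. ennreal \<eta> * indicator {a..b} y \<partial>lborel)"
    using support close
    by (intro nn_integral_mono) (auto intro!: ennreal_leI split: split_indicator)
  also have "\<dots> = ennreal (\<eta> * (b - a))"
    using \<open>a \<le> b\<close> \<open>\<eta> \<ge> 0\<close> by (subst nn_integral_cmult_indicator) (auto simp: ennreal_mult)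
  finally show "(\<integral>\<^sup>+y. norm (indicator {a..b} y *\<^sub>R f y - s y) \<partial>lborel) \<le> ennreal (\<eta> * (b - a))" .
next
  let ?I = "Bochner_Integration.simple_bochner_integral lborel s"
  have "((\<lambda>y. if y \<in> {a..b} then s y else 0) has_integral ?I) UNIV"
    using simple_bochner_integrable_has_integral[OF s]
    by (rule has_integral_eq[rotated]) (simp add: support)
  then have "(s has_integral ?I) {a..b}" by (simp only: has_integral_restrict_UNIV)
  then have "((\<lambda>y. f y - s y) has_integral integral {a..b} f - ?I) {a..b}"
    using f by (intro has_integral_diff integrable_integral integrable_continuous_real)
  from has_integral_bound_real[OF _ _ this, of \<eta> "{}"]
  show "norm (?I - integral {a..b} f) \<le> \<eta> * (b - a)"
    using close \<open>\<eta> \<ge> 0\<close> \<open>a \<le> b\<close> by (simp add: norm_minus_commute)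
qed

lemma has_Bochner_integral_continuous_on:
  fixes f :: "real \<Rightarrow> 'a::banach"
  assumes f: "continuous_on {a..b} f" and "a \<le> b"
  shows "has_Bochner_integral lborel (\<lambda>y. indicator {a..b} y *\<^sub>R f y) (integral {a..b} f)"
proof -
  define \<eta> where "\<eta> n = inverse (real (Suc n))" for n
  have \<eta>_pos: "\<eta> n > 0" for n by (simp add: \<eta>_def)
  have "\<exists>s. Bochner_Integration.simple_bochner_integrable lborel s \<and> (\<forall>y. y \<notin> {a..b} \<longrightarrow> s y = 0) \<and>
      (\<forall>y\<in>{a..b}. norm (f y - s y) \<le> \<eta> n)" for n
    using continuous_on_Icc_simple_approximation[OF f \<eta>_pos] by metis
  then obtain s where s: "\<And>n. Bochner_Integration.simple_bochner_integrable lborel (s n)"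
    and support: "\<And>n y. y \<notin> {a..b} \<Longrightarrow> s n y = 0"
    and close: "\<And>n y. y \<in> {a..b} \<Longrightarrow> norm (f y - s n y) \<le> \<eta> n"
    by metis
  note bounds = f \<open>a \<le> b\<close> less_imp_le[OF \<eta>_pos] s support close
  have error: "(\<lambda>n. \<eta> n * (b - a)) \<longlonglongrightarrow> 0"
    unfolding \<eta>_def by (intro tendsto_mult_left_zero LIMSEQ_inverse_real_of_nat)
  show ?thesis
  proof
    show "(\<lambda>y. indicator {a..b} y *\<^sub>R f y) \<in> borel_measurable lborel"
      using f by (simp add: borel_measurable_continuous_on_indicator)
    show "Bochner_Integration.simple_bochner_integrable lborel (s n)" for n
      by (rule s)
    show "(\<lambda>n. \<integral>\<^sup>+y. norm (indicator {a..b} y *\<^sub>R f y - s n y) \<partial>lborel) \<longlonglongrightarrow> 0"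
    proof (rule tendsto_sandwich[OF _ _ tendsto_const])
      show "(\<lambda>n. ennreal (\<eta> n * (b - a))) \<longlonglongrightarrow> 0"
        using tendsto_ennrealI[OF error] by simp
    qed (auto intro!: always_eventually nn_integral_norm_diff_simple_le bounds)
    show "(\<lambda>n. Bochner_Integration.simple_bochner_integral lborel (s n)) \<longlonglongrightarrow> integral {a..b} f"
      by (rule LIM_zero_cancel, rule Lim_null_comparison[OF _ error])
         (intro always_eventually allI norm_simple_bochner_integral_diff_integral_le bounds)
  qed
qed

section \<open>Almost periodic functions\<close>

lemma relatively_dense_mono:
  assumes "S \<subseteq> S'" and "relatively_dense S"
  shows "relatively_dense S'"
  using assms unfolding relatively_dense_def by blast

lemma Bohr_almost_periodic_iff:
  "Bohr_almost_periodic f \<longleftrightarrow>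
    continuous_on UNIV f \<and> (\<forall>\<epsilon>>0. relatively_dense {t. \<forall>x. dist (f x) (f (x - t)) < \<epsilon>})"
proof -
  let ?sup = "\<lambda>t. SUP x. ereal (norm (f x - f (x - t)))"
  have "{t. ?sup t < ereal \<epsilon>} \<subseteq> {t. \<forall>x. dist (f x) (f (x - t)) < \<epsilon>}" for \<epsilon>
  proof (intro subsetI CollectI allI)
    fix t x assume "t \<in> {t. ?sup t < ereal \<epsilon>}"
    then have "?sup t < ereal \<epsilon>" by simp
    moreover have "ereal (norm (f x - f (x - t))) \<le> ?sup t" by (intro SUP_upper) simp
    ultimately have "ereal (norm (f x - f (x - t))) < ereal \<epsilon>"
      by (rule order.strict_trans1[rotated])
    then show "dist (f x) (f (x - t)) < \<epsilon>" by (simp add: dist_norm)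
  qed
  moreover have "{t. \<forall>x. dist (f x) (f (x - t)) < \<epsilon> / 2} \<subseteq> {t. ?sup t < ereal \<epsilon>}" if "\<epsilon> > 0" for \<epsilon>
  proof (intro subsetI CollectI)
    fix t assume "t \<in> {t. \<forall>x. dist (f x) (f (x - t)) < \<epsilon> / 2}"
    then have "?sup t \<le> ereal (\<epsilon> / 2)"
      by (intro SUP_least) (auto simp: dist_norm intro: less_imp_le)
    also have "\<dots> < ereal \<epsilon>" using \<open>\<epsilon> > 0\<close> by simp
    finally show "?sup t < ereal \<epsilon>" .
  qed
  ultimately show ?thesis
    unfolding Bohr_almost_periodic_def by (meson half_gt_zero relatively_dense_mono)
qed

lemma Bohr_almost_periodic_imp_continuous_on:
  assumes "Bohr_almost_periodic f"
  shows "continuous_on A f"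
  using assms continuous_on_subset[of UNIV f A] by (simp add: Bohr_almost_periodic_iff)

lemma Bohr_almost_periodicE:
  assumes "Bohr_almost_periodic f" and "\<epsilon> > 0"
  obtains l where "l > 0" "\<And>a. \<exists>t\<in>{a..a + l}. \<forall>x. dist (f x) (f (x - t)) < \<epsilon>"
proof -
  have "relatively_dense {t. \<forall>x. dist (f x) (f (x - t)) < \<epsilon>}"
    using assms by (simp add: Bohr_almost_periodic_iff)
  then obtain l where "l > 0" "\<And>a. {t. \<forall>x. dist (f x) (f (x - t)) < \<epsilon>} \<inter> {a..a + l} \<noteq> {}"
    unfolding relatively_dense_def by blast
  then show thesis by (intro that[of l]) blast+
qed

lemma Bohr_almost_periodic_imp_uniformly_continuous_on:
  assumes f: "Bohr_almost_periodic f"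
  shows "uniformly_continuous_on UNIV f"
  unfolding uniformly_continuous_on_def
proof (intro allI impI)
  fix \<epsilon> :: real assume "\<epsilon> > 0"
  then have "\<epsilon> / 3 > 0" by simp
  obtain l where period: "\<And>a. \<exists>t\<in>{a..a + l}. \<forall>x. dist (f x) (f (x - t)) < \<epsilon> / 3"
    using Bohr_almost_periodicE[OF f \<open>\<epsilon> / 3 > 0\<close>] by blast
  have "uniformly_continuous_on {-1..l + 1} f"
    by (intro compact_uniformly_continuous Bohr_almost_periodic_imp_continuous_on f) simp
  then obtain d where "d > 0"
    and near: "\<And>x y. x \<in> {-1..l + 1} \<Longrightarrow> y \<in> {-1..l + 1} \<Longrightarrow> dist y x < d \<Longrightarrow>
      dist (f y) (f x) < \<epsilon> / 3"
    using \<open>\<epsilon> / 3 > 0\<close> by (rule uniformly_continuous_onE) blast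
  have "dist (f y) (f x) < \<epsilon>" if "dist y x < min d 1" for x y
  proof -
    obtain t where t: "t \<in> {x - l..x - l + l}" "\<forall>z. dist (f z) (f (z - t)) < \<epsilon> / 3"
      using period by blast
    have "dist (f (y - t)) (f (x - t)) < \<epsilon> / 3"
      using that t(1) by (intro near) (auto simp: dist_real_def abs_if split: if_splits)
    with spec[OF t(2), of x] spec[OF t(2), of y] show ?thesis by metric
  qed
  then show "\<exists>d>0. \<forall>x\<in>UNIV. \<forall>y\<in>UNIV. dist y x < d \<longrightarrow> dist (f y) (f x) < \<epsilon>"
    using \<open>d > 0\<close> by (intro exI[of _ "min d 1"]) auto
qed

lemma Bohr_almost_periodic_imp_compact_closure_range:
  fixes f :: "real \<Rightarrow> 'a::banach"
  assumes f: "Bohr_almost_periodic f"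
  shows "compact (closure (range f))"
  unfolding compact_eq_totally_bounded
proof (intro conjI allI impI)
  show "complete (closure (range f))" by (simp add: complete_eq_closed)
  fix \<epsilon> :: real assume "\<epsilon> > 0"
  then have "\<epsilon> / 3 > 0" by simp
  obtain l where period: "\<And>a. \<exists>t\<in>{a..a + l}. \<forall>x. dist (f x) (f (x - t)) < \<epsilon> / 3"
    using Bohr_almost_periodicE[OF f \<open>\<epsilon> / 3 > 0\<close>] by blast
  have "compact (f ` {0..l})"
    by (intro compact_continuous_image Bohr_almost_periodic_imp_continuous_on f) simp
  then obtain k where "finite k" and cover: "f ` {0..l} \<subseteq> (\<Union>x\<in>k. ball x (\<epsilon> / 3))"
    using \<open>\<epsilon> / 3 > 0\<close> unfolding compact_eq_totally_bounded by meson
  have "closure (range f) \<subseteq> (\<Union>x\<in>k. ball x \<epsilon>)"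
  proof
    fix y assume "y \<in> closure (range f)"
    then obtain x where "dist (f x) y < \<epsilon> / 3"
      using \<open>\<epsilon> / 3 > 0\<close> by (metis closure_approachable rangeE)
    obtain t where t: "t \<in> {x - l..x - l + l}" "\<forall>z. dist (f z) (f (z - t)) < \<epsilon> / 3"
      using period by blast
    have "f (x - t) \<in> (\<Union>x\<in>k. ball x (\<epsilon> / 3))"
      using t(1) by (intro subsetD[OF cover] imageI) auto
    then obtain v where "v \<in> k" "dist v (f (x - t)) < \<epsilon> / 3" by auto
    with \<open>dist (f x) y < \<epsilon> / 3\<close> spec[OF t(2), of x] have "dist v y < \<epsilon>" by metric
    with \<open>v \<in> k\<close> show "y \<in> (\<Union>x\<in>k. ball x \<epsilon>)" by auto
  qed
  with \<open>finite k\<close> show "\<exists>k. finite k \<and> closure (range f) \<subseteq> (\<Union>x\<in>k. ball x \<epsilon>)" by blast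
qed

lemma Bohr_almost_periodic_imp_bounded:
  fixes f :: "real \<Rightarrow> 'a::banach"
  assumes "Bohr_almost_periodic f"
  shows "bounded (range f)"
  using compact_imp_bounded[OF Bohr_almost_periodic_imp_compact_closure_range[OF assms]]
  by (rule bounded_subset) (rule closure_subset)

lemma Bohr_almost_periodic_compose:
  assumes f: "Bohr_almost_periodic f" and \<phi>: "uniformly_continuous_on K \<phi>" and "range f \<subseteq> K"
  shows "Bohr_almost_periodic (\<lambda>x. \<phi> (f x))"
  unfolding Bohr_almost_periodic_iff
proof (intro conjI allI impI)
  show "continuous_on UNIV (\<lambda>x. \<phi> (f x))"
    by (rule continuous_on_compose2[OF uniformly_continuous_imp_continuous[OF \<phi>] _ \<open>range f \<subseteq> K\<close>])
       (rule Bohr_almost_periodic_imp_continuous_on[OF f])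
  fix \<epsilon> :: real assume "\<epsilon> > 0"
  with \<phi> obtain d where "d > 0"
    "\<And>y z. y \<in> K \<Longrightarrow> z \<in> K \<Longrightarrow> dist z y < d \<Longrightarrow> dist (\<phi> z) (\<phi> y) < \<epsilon>"
    by (rule uniformly_continuous_onE) blast
  with \<open>range f \<subseteq> K\<close>
  have "{t. \<forall>x. dist (f x) (f (x - t)) < d} \<subseteq> {t. \<forall>x. dist (\<phi> (f x)) (\<phi> (f (x - t))) < \<epsilon>}"
    by blast
  moreover have "relatively_dense {t. \<forall>x. dist (f x) (f (x - t)) < d}"
    using f \<open>d > 0\<close> by (simp add: Bohr_almost_periodic_iff)
  ultimately show "relatively_dense {t. \<forall>x. dist (\<phi> (f x)) (\<phi> (f (x - t))) < \<epsilon>}"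
    by (rule relatively_dense_mono)
qed

section \<open>The mean of an almost periodic function\<close>

lemma norm_integral_le:
  fixes f :: "real \<Rightarrow> 'a::banach"
  assumes "continuous_on UNIV f" and "\<And>x. norm (f x) \<le> B" and "T \<ge> 0"
  shows "norm (integral {a..a + T} f) \<le> T * B"
  using integral_bound[of a "a + T" f B] continuous_on_subset[OF assms(1)] assms(2,3)
  by (simp add: mult.commute)

lemma norm_window_mean_diff_le:
  fixes f g :: "real \<Rightarrow> 'a::banach"
  assumes f: "continuous_on UNIV f" and g: "continuous_on UNIV g"
    and close: "\<And>x. norm (f x - g x) \<le> \<epsilon>" and "L > 0"
  shows "norm (window_mean f a L - window_mean g a L) \<le> \<epsilon>"
proof -
  have "window_mean f a L - window_mean g a L = integral {a..a + L} (\<lambda>x. f x - g x) /\<^sub>R L"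
    unfolding window_mean_def
    by (subst integral_diff)
       (auto intro!: continuous_UNIV_imp_integrable_Icc f g simp: scaleR_diff_right)
  moreover have "norm (integral {a..a + L} (\<lambda>x. f x - g x)) \<le> L * \<epsilon>"
    using \<open>L > 0\<close> by (intro norm_integral_le continuous_on_diff f g close) auto
  ultimately show ?thesis using \<open>L > 0\<close> by (simp add: field_simps)
qed

lemma norm_window_mean_translate_le:
  fixes f :: "real \<Rightarrow> 'a::banach"
  assumes f: "continuous_on UNIV f" and f_bound: "\<And>x. norm (f x) \<le> B" and "s \<ge> 0" "L > 0"
  shows "norm (window_mean f a L - window_mean f (a + s) L) \<le> 2 * s * B / L"
proof -
  note combine =
    Henstock_Kurzweil_Integration.integral_combine[OF _ _ continuous_UNIV_imp_integrable_Icc[OF f]]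
  have "integral {a..a + L} f + integral {a + L..a + L + s} f = integral {a..a + L + s} f"
    using \<open>s \<ge> 0\<close> \<open>L > 0\<close> by (intro combine) auto
  moreover have "integral {a..a + s} f + integral {a + s..a + L + s} f = integral {a..a + L + s} f"
    using \<open>s \<ge> 0\<close> \<open>L > 0\<close> by (intro combine) auto
  ultimately have "integral {a..a + L} f - integral {a + s..a + s + L} f
      = integral {a..a + s} f - integral {a + L..a + L + s} f"
    by (simp add: algebra_simps)
  also have "norm \<dots> \<le> s * B + s * B"
    using norm_integral_le[OF f f_bound \<open>s \<ge> 0\<close>]
    by (intro order_trans[OF norm_triangle_ineq4] add_mono)
  finally have "norm (integral {a..a + L} f - integral {a + s..a + s + L} f) \<le> 2 * s * B"
    by (simp add: mult.commute)
  then show ?thesis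
    using \<open>L > 0\<close> unfolding window_mean_def scaleR_diff_right[symmetric] norm_scaleR
    by (simp add: divide_inverse_commute mult_left_mono)
qed

lemma Bohr_almost_periodic_window_mean_translate_close:
  fixes f :: "real \<Rightarrow> 'a::banach"
  assumes f: "Bohr_almost_periodic f" and "\<epsilon> > 0"
  shows "\<exists>L0>0. \<forall>L\<ge>L0. \<forall>a b. norm (window_mean f a L - window_mean f b L) \<le> \<epsilon>"
proof -
  obtain B where "B > 0" and f_bound: "\<And>x. norm (f x) \<le> B"
    using Bohr_almost_periodic_imp_bounded[OF f] by (auto simp: bounded_pos)
  have f_cont: "continuous_on UNIV f" by (rule Bohr_almost_periodic_imp_continuous_on[OF f])
  obtain l where "l > 0" and period: "\<And>a. \<exists>t\<in>{a..a + l}. \<forall>x. dist (f x) (f (x - t)) < \<epsilon> / 2"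
    using Bohr_almost_periodicE[OF f, of "\<epsilon> / 2"] \<open>\<epsilon> > 0\<close> by auto
  define L0 where "L0 = 4 * l * B / \<epsilon>"
  have "L0 > 0" using \<open>l > 0\<close> \<open>B > 0\<close> \<open>\<epsilon> > 0\<close> by (simp add: L0_def)
  moreover have "norm (window_mean f a L - window_mean f b L) \<le> \<epsilon>" if "L \<ge> L0" for L a b
  proof -
    have "L > 0" using \<open>L0 > 0\<close> that by simp
    obtain t where t: "t \<in> {a - b..a - b + l}" "\<forall>x. dist (f x) (f (x - t)) < \<epsilon> / 2"
      using period by blast
    define s where "s = b + t - a"
    have "0 \<le> s" "s \<le> l" using t(1) by (auto simp: s_def)
    have "norm (window_mean f a L - window_mean f (a + s) L) \<le> 2 * s * B / L"
      using \<open>0 \<le> s\<close> \<open>L > 0\<close> by (intro norm_window_mean_translate_le f_cont f_bound)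
    also have "\<dots> \<le> 2 * l * B / L"
      using \<open>s \<le> l\<close> \<open>B > 0\<close> \<open>L > 0\<close> by (intro divide_right_mono) auto
    also have "\<dots> \<le> \<epsilon> / 2" using that \<open>L > 0\<close> \<open>\<epsilon> > 0\<close> by (simp add: L0_def field_simps)
    finally have drift: "norm (window_mean f a L - window_mean f (a + s) L) \<le> \<epsilon> / 2" .
    have "window_mean f (a + s) L = window_mean (\<lambda>x. f (x + t)) b L"
      using integral_shift_Icc_real[of b "b + L" f t]
      by (simp add: window_mean_def s_def o_def algebra_simps)
    moreover have "norm (window_mean (\<lambda>x. f (x + t)) b L - window_mean f b L) \<le> \<epsilon> / 2"
    proof (intro norm_window_mean_diff_le f_cont \<open>L > 0\<close>)
      show "continuous_on UNIV (\<lambda>x. f (x + t))"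
        by (intro continuous_on_compose2[OF f_cont] continuous_intros) simp
      show "norm (f (x + t) - f x) \<le> \<epsilon> / 2" for x
        using spec[OF t(2), of "x + t"] by (simp add: dist_norm less_imp_le)
    qed
    ultimately show ?thesis
      using norm_diff_triangle_le[OF drift, of "window_mean f b L" "\<epsilon> / 2"] by simp
  qed
  ultimately show ?thesis by blast
qed

text \<open>
  By Fubini, both window means are close to the average of \<open>f (s + t)\<close> over \<open>0 \<le> s \<le> S\<close> and
  \<open>0 \<le> t \<le> T\<close>.
\<close>

lemma norm_window_mean_diff_lengths_le:
  fixes f :: "real \<Rightarrow> 'a::banach"
  assumes f: "continuous_on UNIV f" and "S > 0" "T > 0"
    and S_close: "\<And>a b. norm (window_mean f a S - window_mean f b S) \<le> \<epsilon>"
    and T_close: "\<And>a b. norm (window_mean f a T - window_mean f b T) \<le> \<epsilon>"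
  shows "norm (window_mean f a S - window_mean f b T) \<le> 2 * \<epsilon>"
proof -
  have cont: "continuous_on UNIV (\<lambda>s. window_mean f s L)" for L
    unfolding window_mean_def by (intro continuous_intros continuous_on_window_integral f)
  have average_close: "norm (window_mean (\<lambda>s. window_mean f s L) 0 M - window_mean f b L) \<le> \<epsilon>"
    if "M > 0" and "\<And>a. norm (window_mean f a L - window_mean f b L) \<le> \<epsilon>" for L M b
  proof -
    have "window_mean (\<lambda>_. window_mean f b L) 0 M = window_mean f b L"
      using \<open>M > 0\<close> by (simp add: window_mean_def[of "\<lambda>_. _"])
    with norm_window_mean_diff_le[OF cont continuous_on_const that(2,1)] show ?thesis by metis
  qed
  have "window_mean (\<lambda>s. window_mean f s T) 0 S = window_mean (\<lambda>s. window_mean f s S) 0 T"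
    using integral_window_integrals_swap[OF f, of 0 S T] by (simp add: window_mean_def mult.commute)
  with average_close[OF \<open>S > 0\<close> T_close, of b]
  have T_average: "norm (window_mean (\<lambda>s. window_mean f s S) 0 T - window_mean f b T) \<le> \<epsilon>"
    by simp
  have "norm (window_mean f a S - window_mean (\<lambda>s. window_mean f s S) 0 T) \<le> \<epsilon>"
    using average_close[OF \<open>T > 0\<close> S_close, of a] by (simp add: norm_minus_commute)
  from norm_diff_triangle_le[OF this T_average] show ?thesis by simp
qed

lemma Bohr_almost_periodic_window_means_close:
  fixes f :: "real \<Rightarrow> 'a::banach"
  assumes f: "Bohr_almost_periodic f" and "\<epsilon> > 0"
  obtains L0 where "L0 > 0"
    "\<And>S T a b. S \<ge> L0 \<Longrightarrow> T \<ge> L0 \<Longrightarrow> norm (window_mean f a S - window_mean f b T) \<le> \<epsilon>"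
proof -
  obtain L0 where "L0 > 0"
    and L0: "\<And>L a b. L \<ge> L0 \<Longrightarrow> norm (window_mean f a L - window_mean f b L) \<le> \<epsilon> / 2"
    using Bohr_almost_periodic_window_mean_translate_close[OF f half_gt_zero[OF \<open>\<epsilon> > 0\<close>]] by blast
  have "norm (window_mean f a S - window_mean f b T) \<le> 2 * (\<epsilon> / 2)" if "S \<ge> L0" "T \<ge> L0" for S T a b
    using \<open>L0 > 0\<close> that L0
    by (intro norm_window_mean_diff_lengths_le Bohr_almost_periodic_imp_continuous_on f) auto
  with \<open>L0 > 0\<close> show thesis by (intro that[of L0]) auto
qed

lemma Bohr_almost_periodic_window_means_converge:
  fixes f :: "real \<Rightarrow> 'a::banach"
  assumes f: "Bohr_almost_periodic f"
  obtains m where "\<And>\<epsilon>. \<epsilon> > 0 \<Longrightarrow> \<exists>L0>0. \<forall>L\<ge>L0. \<forall>a. norm (window_mean f a L - m) \<le> \<epsilon>"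
proof -
  have large: "\<forall>\<^sub>F n in sequentially. real n \<ge> L0" for L0
    using filterlim_real_sequentially by (simp add: filterlim_at_top)
  have "Cauchy (\<lambda>n. window_mean f 0 (real n))"
  proof (rule metric_CauchyI)
    fix \<epsilon> :: real assume "\<epsilon> > 0"
    obtain L0 where close: "\<And>S T a b. S \<ge> L0 \<Longrightarrow> T \<ge> L0 \<Longrightarrow>
        norm (window_mean f a S - window_mean f b T) \<le> \<epsilon> / 2"
      by (rule Bohr_almost_periodic_window_means_close[OF f half_gt_zero[OF \<open>\<epsilon> > 0\<close>]]) blast
    obtain k where k: "\<And>n. n \<ge> k \<Longrightarrow> real n \<ge> L0"
      using large[of L0] by (auto simp: eventually_sequentially)
    have "dist (window_mean f 0 (real i)) (window_mean f 0 (real j)) < \<epsilon>" if "i \<ge> k" "j \<ge> k" for i j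
      using close[OF k[OF that(1)] k[OF that(2)], of 0 0] \<open>\<epsilon> > 0\<close> by (simp add: dist_norm)
    then show "\<exists>k. \<forall>i\<ge>k. \<forall>j\<ge>k. dist (window_mean f 0 (real i)) (window_mean f 0 (real j)) < \<epsilon>"
      by blast
  qed
  then obtain m where m: "(\<lambda>n. window_mean f 0 (real n)) \<longlonglongrightarrow> m"
    using Cauchy_convergent convergentD by blast
  have "\<exists>L0>0. \<forall>L\<ge>L0. \<forall>a. norm (window_mean f a L - m) \<le> \<epsilon>" if "\<epsilon> > 0" for \<epsilon>
  proof -
    obtain L0 where "L0 > 0" and L0: "\<And>S T a b. S \<ge> L0 \<Longrightarrow> T \<ge> L0 \<Longrightarrow>
        norm (window_mean f a S - window_mean f b T) \<le> \<epsilon>"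
      by (rule Bohr_almost_periodic_window_means_close[OF f \<open>\<epsilon> > 0\<close>]) blast
    have "norm (window_mean f a L - m) \<le> \<epsilon>" if "L \<ge> L0" for a L
    proof (rule tendsto_upperbound)
      show "(\<lambda>n. norm (window_mean f a L - window_mean f 0 (real n)))
          \<longlonglongrightarrow> norm (window_mean f a L - m)"
        by (intro tendsto_intros m)
      show "\<forall>\<^sub>F n in sequentially. norm (window_mean f a L - window_mean f 0 (real n)) \<le> \<epsilon>"
        using large[of L0] by eventually_elim (use L0 that in blast)
    qed simp
    with \<open>L0 > 0\<close> show ?thesis by blast
  qed
  with that show thesis by blast
qed

definition has_mean :: "(real \<Rightarrow> 'a::banach) \<Rightarrow> 'a \<Rightarrow> bool" where
  "has_mean f m \<longleftrightarrow> ((\<lambda>T. window_mean f (- T) (2 * T)) \<longlongrightarrow> m) at_top"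

lemma has_mean_imp_mean_eq:
  assumes f: "continuous_on UNIV f" and m: "has_mean f m"
  shows "mean f = m"
proof -
  let ?mean = "\<lambda>T. (1 / (2 * T)) *\<^sub>R Bochner_integral lborel (\<lambda>y. indicator {-T..T} y *\<^sub>R f y)"
  have "\<forall>\<^sub>F T in at_top. window_mean f (- T) (2 * T) = ?mean T"
    using eventually_gt_at_top[of 0]
  proof eventually_elim
    case (elim T)
    then have "has_Bochner_integral lborel (\<lambda>y. indicator {-T..T} y *\<^sub>R f y) (integral {-T..T} f)"
      by (intro has_Bochner_integral_continuous_on continuous_on_subset[OF f]) auto
    then show ?case by (simp add: window_mean_def Bochner_integral_eqI inverse_eq_divide)
  qed
  with m have "(?mean \<longlongrightarrow> m) at_top"
    unfolding has_mean_def by (rule Lim_transform_eventually)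
  then show ?thesis unfolding mean_def by (intro tendsto_Lim) auto
qed

lemma norm_has_mean_diff_le:
  assumes f: "continuous_on UNIV f" and g: "continuous_on UNIV g"
    and m: "has_mean f m" "has_mean g m'" and close: "\<And>x. norm (f x - g x) \<le> \<epsilon>"
  shows "norm (m - m') \<le> \<epsilon>"
proof (rule tendsto_upperbound)
  let ?diff = "\<lambda>T. norm (window_mean f (- T) (2 * T) - window_mean g (- T) (2 * T))"
  show "(?diff \<longlongrightarrow> norm (m - m')) at_top"
    using m unfolding has_mean_def by (intro tendsto_intros)
  show "\<forall>\<^sub>F T in at_top. ?diff T \<le> \<epsilon>"
    using eventually_gt_at_top[of 0]
    by eventually_elim (intro norm_window_mean_diff_le f g close, simp)
qed simp

lemma has_mean_sum_scaleR:
  fixes g :: "'i \<Rightarrow> real \<Rightarrow> real" and c :: "'i \<Rightarrow> 'a::banach"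
  assumes "finite I" and g: "\<And>i. i \<in> I \<Longrightarrow> continuous_on UNIV (g i)"
    and m: "\<And>i. i \<in> I \<Longrightarrow> has_mean (g i) (m i)"
  shows "has_mean (\<lambda>x. \<Sum>i\<in>I. g i x *\<^sub>R c i) (\<Sum>i\<in>I. m i *\<^sub>R c i)"
proof -
  have "integral {a..b} (\<lambda>x. \<Sum>i\<in>I. g i x *\<^sub>R c i) = (\<Sum>i\<in>I. integral {a..b} (g i) *\<^sub>R c i)" for a b
    by (intro integral_unique has_integral_sum \<open>finite I\<close> has_integral_scaleR_left
        integrable_integral continuous_UNIV_imp_integrable_Icc g)
  then have "window_mean (\<lambda>x. \<Sum>i\<in>I. g i x *\<^sub>R c i) a L
      = (\<Sum>i\<in>I. window_mean (g i) a L *\<^sub>R c i)" for a L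
    by (simp add: window_mean_def scaleR_sum_right)
  then show ?thesis
    using m unfolding has_mean_def by (auto intro!: tendsto_intros)
qed

lemma
  fixes f :: "real \<Rightarrow> 'a::banach"
  assumes f: "Bohr_almost_periodic f"
  shows Bohr_almost_periodic_has_mean: "has_mean f (mean f)"
    and Bohr_almost_periodic_window_means_uniform:
      "\<epsilon> > 0 \<Longrightarrow> \<exists>L0>0. \<forall>L\<ge>L0. \<forall>a. norm (window_mean f a L - mean f) \<le> \<epsilon>"
proof -
  obtain m where m: "\<And>\<epsilon>. \<epsilon> > 0 \<Longrightarrow> \<exists>L0>0. \<forall>L\<ge>L0. \<forall>a. norm (window_mean f a L - m) \<le> \<epsilon>"
    using Bohr_almost_periodic_window_means_converge[OF f] by blast
  have "has_mean f m"
    unfolding has_mean_def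
  proof (rule tendstoI)
    fix \<epsilon> :: real assume "\<epsilon> > 0"
    then obtain L0 where "L0 > 0" and L0: "\<And>L a. L \<ge> L0 \<Longrightarrow> norm (window_mean f a L - m) \<le> \<epsilon> / 2"
      using m[of "\<epsilon> / 2"] by auto
    show "\<forall>\<^sub>F T in at_top. dist (window_mean f (- T) (2 * T)) m < \<epsilon>"
      using eventually_ge_at_top[of L0]
    proof eventually_elim
      case (elim T)
      then have "norm (window_mean f (- T) (2 * T) - m) \<le> \<epsilon> / 2"
        using \<open>L0 > 0\<close> by (intro L0) simp
      then show ?case using \<open>\<epsilon> > 0\<close> by (simp add: dist_norm)
    qed
  qed
  moreover from this have "mean f = m"
    by (intro has_mean_imp_mean_eq Bohr_almost_periodic_imp_continuous_on f)
  ultimately show "has_mean f (mean f)"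
    and "\<epsilon> > 0 \<Longrightarrow> \<exists>L0>0. \<forall>L\<ge>L0. \<forall>a. norm (window_mean f a L - mean f) \<le> \<epsilon>"
    using m by simp_all
qed

section \<open>Convergence of the averages\<close>

lemma AE_tendstoI:
  fixes X :: "'a \<Rightarrow> 'b \<Rightarrow> 'c::metric_space"
  assumes close: "\<And>\<epsilon>. \<epsilon> > 0 \<Longrightarrow> AE x in M. \<forall>\<^sub>F n in F. dist (X x n) l \<le> \<epsilon>"
  shows "AE x in M. (X x \<longlongrightarrow> l) F"
proof -
  have "AE x in M. \<forall>k. \<forall>\<^sub>F n in F. dist (X x n) l \<le> inverse (real (Suc k))"
    unfolding AE_all_countable by (intro allI close) simp
  then show ?thesis
  proof eventually_elim
    case (elim x)
    show ?case
    proof (rule tendstoI)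
      fix \<epsilon> :: real assume "\<epsilon> > 0"
      then obtain k where "inverse (real (Suc k)) < \<epsilon>" using reals_Archimedean by blast
      with elim show "\<forall>\<^sub>F n in F. dist (X x n) l < \<epsilon>"
        by (auto elim!: eventually_mono dest!: spec[of _ k])
    qed
  qed
qed

lemma AE_orbit_average_tendsto_mean_real:
  fixes g :: "real \<Rightarrow> real"
  assumes g: "Bohr_almost_periodic g" and "\<bar>\<alpha>\<bar> > 1"
  shows "AE x in lebesgue. orbit_average \<alpha> g x \<longlonglongrightarrow> mean g"
proof (rule AE_tendstoI)
  fix \<epsilon> :: real assume "\<epsilon> > 0"
  obtain L where "L > 0" and L: "\<And>M c. M \<ge> L \<Longrightarrow> norm (window_mean g c M - mean g) \<le> \<epsilon> / 2"
    using Bohr_almost_periodic_window_means_uniform[OF g half_gt_zero[OF \<open>\<epsilon> > 0\<close>]] by blast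
  have window: "window_mean g c M \<le> mean g + \<epsilon> / 2"
    "window_mean (\<lambda>x. - g x) c M \<le> - mean g + \<epsilon> / 2" if "M \<ge> L" for c M
    using L[OF that, of c]
    by (simp_all only: window_mean_def real_norm_def integral_neg scaleR_minus_right)
  note g_uc = Bohr_almost_periodic_imp_uniformly_continuous_on[OF g]
  note g_bounded = Bohr_almost_periodic_imp_bounded[OF g]
  have "AE x in lebesgue. \<forall>\<^sub>F N in sequentially. orbit_average \<alpha> g x N \<le> mean g + \<epsilon> / 2 + \<epsilon> / 2"
    using g_uc g_bounded \<open>L > 0\<close> window(1) \<open>\<epsilon> > 0\<close> \<open>\<bar>\<alpha>\<bar> > 1\<close> 
    by (intro AE_orbit_average_le[where L = L]) auto
  moreover have "AE x in lebesgue. \<forall>\<^sub>F N in sequentially.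
      orbit_average \<alpha> (\<lambda>x. - g x) x N \<le> - mean g + \<epsilon> / 2 + \<epsilon> / 2"
    using \<open>L > 0\<close> window(2) \<open>\<epsilon> > 0\<close> \<open>\<bar>\<alpha>\<bar> > 1\<close> g_bounded
    by (intro AE_orbit_average_le[where L = L] uniformly_continuous_on_minus g_uc)
       (auto simp: bounded_iff)
  ultimately
  show "AE x in lebesgue. \<forall>\<^sub>F N in sequentially. dist (orbit_average \<alpha> g x N) (mean g) \<le> \<epsilon>"
  proof eventually_elim
    case (elim x)
    then show ?case
      by eventually_elim (simp add: orbit_average_def sum_negf dist_real_def abs_le_iff)
  qed
qed

lemma compact_partition_of_unity_balls:
  fixes K :: "'a::metric_space set"
  assumes "compact K" and "\<epsilon> > 0"
  obtains I and \<phi> :: "'a set \<Rightarrow> 'a \<Rightarrow> real" and c where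
    "finite I" "\<And>U. U \<in> I \<Longrightarrow> continuous_on K (\<phi> U)" "\<And>U y. U \<in> I \<Longrightarrow> y \<in> K \<Longrightarrow> \<phi> U y \<ge> 0"
    "\<And>y. y \<in> K \<Longrightarrow> (\<Sum>U\<in>I. \<phi> U y) = 1"
    "\<And>U y. U \<in> I \<Longrightarrow> y \<in> K \<Longrightarrow> \<phi> U y \<noteq> 0 \<Longrightarrow> dist y (c U) < \<epsilon>"
proof -
  obtain k where "finite k" and cover: "K \<subseteq> (\<Union>v\<in>k. ball v \<epsilon>)"
    using assms unfolding compact_eq_totally_bounded by blast
  define I where "I = (\<lambda>v. ball v \<epsilon>) ` k"
  have "finite I" using \<open>finite k\<close> by (simp add: I_def)
  obtain c where c: "\<And>U. U \<in> I \<Longrightarrow> U = ball (c U) \<epsilon>" unfolding I_def by (metis imageE)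
  obtain \<phi> :: "'a set \<Rightarrow> 'a \<Rightarrow> real"
    where \<phi>: "\<And>U. U \<in> I \<Longrightarrow> continuous_on K (\<phi> U) \<and> (\<forall>y\<in>K. 0 \<le> \<phi> U y)"
      and \<phi>_support: "\<And>y U. U \<in> I \<Longrightarrow> y \<in> K \<Longrightarrow> y \<notin> U \<Longrightarrow> \<phi> U y = 0"
      and \<phi>_supp_sum: "\<And>y. y \<in> K \<Longrightarrow> supp_sum (\<lambda>U. \<phi> U y) I = 1"
  proof (rule subordinate_partition_of_unity[of K I])
    show "K \<subseteq> \<Union> I" using cover by (simp add: I_def)
    show "open U" if "U \<in> I" for U using that by (auto simp: I_def)
    show "\<exists>V. open V \<and> y \<in> V \<and> finite {U \<in> I. U \<inter> V \<noteq> {}}" for y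
      using \<open>finite I\<close> by (intro exI[of _ UNIV]) simp
  qed blast
  have "(\<Sum>U\<in>I. \<phi> U y) = 1" if "y \<in> K" for y
    using \<phi>_supp_sum[OF that] \<open>finite I\<close>
    by (simp add: supp_sum_def support_on_def sum.mono_neutral_right[of I "{U \<in> I. \<phi> U y \<noteq> 0}"])
  moreover have "dist y (c U) < \<epsilon>" if "U \<in> I" "y \<in> K" "\<phi> U y \<noteq> 0" for U y
    using \<phi>_support[OF that(1,2)] c[OF that(1)] that(3) by (metis dist_commute mem_ball)
  ultimately show thesis using \<open>finite I\<close> \<phi> by (intro that[of I \<phi> c]) auto
qed

lemma compact_finite_rank_approximation:
  fixes K :: "'a::real_normed_vector set"
  assumes "compact K" and "\<epsilon> > 0"
  obtains I and \<phi> :: "'a set \<Rightarrow> 'a \<Rightarrow> real" and c where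
    "finite I" "\<And>U. U \<in> I \<Longrightarrow> continuous_on K (\<phi> U)"
    "\<And>y. y \<in> K \<Longrightarrow> norm (y - (\<Sum>U\<in>I. \<phi> U y *\<^sub>R c U)) \<le> \<epsilon>"
proof -
  obtain I and \<phi> :: "'a set \<Rightarrow> 'a \<Rightarrow> real" and c where "finite I"
    and \<phi>_cont: "\<And>U. U \<in> I \<Longrightarrow> continuous_on K (\<phi> U)"
    and \<phi>_nonneg: "\<And>U y. U \<in> I \<Longrightarrow> y \<in> K \<Longrightarrow> \<phi> U y \<ge> 0"
    and \<phi>_sum: "\<And>y. y \<in> K \<Longrightarrow> (\<Sum>U\<in>I. \<phi> U y) = 1"
    and \<phi>_support: "\<And>U y. U \<in> I \<Longrightarrow> y \<in> K \<Longrightarrow> \<phi> U y \<noteq> 0 \<Longrightarrow> dist y (c U) < \<epsilon>"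
    by (rule compact_partition_of_unity_balls[OF assms]) blast
  have "norm (y - (\<Sum>U\<in>I. \<phi> U y *\<^sub>R c U)) \<le> \<epsilon>" if "y \<in> K" for y
  proof -
    have "y - (\<Sum>U\<in>I. \<phi> U y *\<^sub>R c U) = (\<Sum>U\<in>I. \<phi> U y *\<^sub>R (y - c U))"
      by (simp add: scaleR_diff_right sum_subtractf \<phi>_sum[OF that] flip: scaleR_sum_left)
    also have "norm \<dots> \<le> (\<Sum>U\<in>I. \<phi> U y * \<epsilon>)"
    proof (intro sum_norm_le)
      fix U assume "U \<in> I"
      then show "norm (\<phi> U y *\<^sub>R (y - c U)) \<le> \<phi> U y * \<epsilon>"
        using \<phi>_nonneg[of U y] \<phi>_support[of U y] that
        by (cases "\<phi> U y = 0") (simp_all add: dist_norm mult_left_mono)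
    qed
    also have "\<dots> = \<epsilon>" by (simp add: \<phi>_sum[OF that] flip: sum_distrib_right)
    finally show ?thesis .
  qed
  with \<open>finite I\<close> \<phi>_cont show thesis by (intro that[of I \<phi> c]) auto
qed

lemma Bohr_almost_periodic_finite_rank_approximation:
  fixes f :: "real \<Rightarrow> 'a::banach"
  assumes f: "Bohr_almost_periodic f" and "\<epsilon> > 0"
  obtains I and g :: "'a set \<Rightarrow> real \<Rightarrow> real" and c where
    "finite I" "\<And>U. U \<in> I \<Longrightarrow> Bohr_almost_periodic (g U)"
    "\<And>x. norm (f x - (\<Sum>U\<in>I. g U x *\<^sub>R c U)) \<le> \<epsilon>"
proof -
  have K: "compact (closure (range f))"
    using f by (rule Bohr_almost_periodic_imp_compact_closure_range)
  obtain I and \<phi> :: "'a set \<Rightarrow> 'a \<Rightarrow> real" and c where "finite I"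
    and \<phi>: "\<And>U. U \<in> I \<Longrightarrow> continuous_on (closure (range f)) (\<phi> U)"
    and approx: "\<And>y. y \<in> closure (range f) \<Longrightarrow> norm (y - (\<Sum>U\<in>I. \<phi> U y *\<^sub>R c U)) \<le> \<epsilon>"
    using compact_finite_rank_approximation[OF K \<open>\<epsilon> > 0\<close>] by blast
  show thesis
  proof
    show "Bohr_almost_periodic (\<lambda>x. \<phi> U (f x))" if "U \<in> I" for U
      using f compact_uniformly_continuous[OF \<phi>[OF that] K] closure_subset
      by (rule Bohr_almost_periodic_compose)
    show "norm (f x - (\<Sum>U\<in>I. \<phi> U (f x) *\<^sub>R c U)) \<le> \<epsilon>" for x
      by (intro approx subsetD[OF closure_subset] rangeI)
  qed (rule \<open>finite I\<close>)
qed

lemma norm_orbit_average_diff_le: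
  assumes "\<And>x. norm (f x - g x) \<le> \<epsilon>"
  shows "norm (orbit_average \<alpha> f x N - orbit_average \<alpha> g x N) \<le> \<epsilon>"
proof (cases "N = 0")
  case True
  then show ?thesis using order_trans[OF norm_ge_zero assms] by (simp add: orbit_average_def)
next
  case False
  have "norm (\<Sum>n<N. f (\<alpha> ^ n * x) - g (\<alpha> ^ n * x)) \<le> (\<Sum>n<N. \<epsilon>)"
    by (intro sum_norm_le assms)
  with False show ?thesis
    by (simp add: orbit_average_def sum_subtractf divide_le_eq mult.commute flip: scaleR_diff_right)
qed

lemma orbit_average_sum_scaleR:
  fixes g :: "'i \<Rightarrow> real \<Rightarrow> real" and c :: "'i \<Rightarrow> 'a::real_vector"
  shows "orbit_average \<alpha> (\<lambda>x. \<Sum>i\<in>I. g i x *\<^sub>R c i) x N = (\<Sum>i\<in>I. orbit_average \<alpha> (g i) x N *\<^sub>R c i)"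
proof -
  have "(\<Sum>n<N. \<Sum>i\<in>I. g i (\<alpha> ^ n * x) *\<^sub>R c i) = (\<Sum>i\<in>I. (\<Sum>n<N. g i (\<alpha> ^ n * x)) *\<^sub>R c i)"
    by (subst sum.swap) (simp add: scaleR_sum_left)
  then show ?thesis by (simp add: orbit_average_def scaleR_sum_right)
qed

lemma AE_orbit_average_close_mean:
  fixes f :: "real \<Rightarrow> 'a::banach"
  assumes f: "Bohr_almost_periodic f" and "\<bar>\<alpha>\<bar> > 1" and "\<epsilon> > 0"
  shows "AE x in lebesgue. \<forall>\<^sub>F N in sequentially. dist (orbit_average \<alpha> f x N) (mean f) \<le> \<epsilon>"
proof -
  obtain I and g :: "'a set \<Rightarrow> real \<Rightarrow> real" and c where "finite I"
    and g: "\<And>U. U \<in> I \<Longrightarrow> Bohr_almost_periodic (g U)"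
    and approx: "\<And>x. norm (f x - (\<Sum>U\<in>I. g U x *\<^sub>R c U)) \<le> \<epsilon> / 3"
    using Bohr_almost_periodic_finite_rank_approximation[OF f, of "\<epsilon> / 3"] \<open>\<epsilon> > 0\<close> by auto
  let ?P = "\<lambda>x. \<Sum>U\<in>I. g U x *\<^sub>R c U" and ?m = "\<Sum>U\<in>I. mean (g U) *\<^sub>R c U"
  have P_mean: "has_mean ?P ?m"
    by (intro has_mean_sum_scaleR Bohr_almost_periodic_imp_continuous_on
        Bohr_almost_periodic_has_mean g \<open>finite I\<close>)
  have P_cont: "continuous_on UNIV ?P"
    by (intro continuous_intros Bohr_almost_periodic_imp_continuous_on g)
  have means_close: "dist (mean f) ?m \<le> \<epsilon> / 3"
    unfolding dist_norm
    by (rule norm_has_mean_diff_le[OF _ P_cont _ P_mean approx])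
       (intro Bohr_almost_periodic_imp_continuous_on Bohr_almost_periodic_has_mean f)+
  have "AE x in lebesgue. \<forall>U\<in>I. orbit_average \<alpha> (g U) x \<longlonglongrightarrow> mean (g U)"
    using \<open>finite I\<close> by (intro AE_finite_allI AE_orbit_average_tendsto_mean_real g \<open>\<bar>\<alpha>\<bar> > 1\<close>)
  then show ?thesis
  proof eventually_elim
    case (elim x)
    then have "(\<lambda>N. orbit_average \<alpha> ?P x N) \<longlonglongrightarrow> ?m"
      unfolding orbit_average_sum_scaleR by (intro tendsto_intros) auto
    then have "\<forall>\<^sub>F N in sequentially. dist (orbit_average \<alpha> ?P x N) ?m < \<epsilon> / 3"
      by (rule tendstoD) (use \<open>\<epsilon> > 0\<close> in simp)
    then show ?case
    proof eventually_elim
      case (elim N)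
      have "dist (orbit_average \<alpha> f x N) (orbit_average \<alpha> ?P x N) \<le> \<epsilon> / 3"
        unfolding dist_norm by (rule norm_orbit_average_diff_le[OF approx])
      with elim means_close show ?case by metric
    qed
  qed
qed

theorem theorem5p2:
  fixes f :: "real \<Rightarrow> 'a::banach" and \<alpha> :: real
  assumes "Bohr_almost_periodic f" and "\<bar>\<alpha>\<bar> > 1"
  shows "AE x in lebesgue.
    (\<lambda>N. (1 / real N) *\<^sub>R (\<Sum>n<N. f (\<alpha> ^ n * x))) \<longlonglongrightarrow> mean f"
proof -
  have "AE x in lebesgue. orbit_average \<alpha> f x \<longlonglongrightarrow> mean f"
    by (intro AE_tendstoI AE_orbit_average_close_mean assms)
  then show ?thesis by (simp add: orbit_average_def[abs_def])
qed

end
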